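(* Let $\{Z_n^Q : n\ge 0\}$ be a critical Galton-Watson process in a varying environment $Q=(q_1,q_2,\ldots)$, with offspring generating functions $f_n$, such that there exists $c>0$ with $$f_n'''(1)\le c\, f_n''(1)\,(1+f_n'(1))\qquad\text{for all } n\ge 1.$$ Then, as $n\to\infty$, the law of $Z_n^Q/a_n^Q$ under the conditional probability $\mathbb{P}(\,\cdot\mid Z_n^Q>0)$ converges in distribution to the law of $Y$, where $Y$ is a standard exponential random variable (exponential with mean $1$).
   Context: A varying environment is a sequence $Q=(q_1,q_2,\ldots)$ of probability measures on $\mathbb{N}_0=\{0,1,2,\ldots\}$. The Galton-Watson process in varying environment $Q$ (GWVE) is defined by $Z_0^Q=1$ and $Z_n^Q=\sum_{i=1}^{Z_{n-1}^Q}\chi_i^{(n)}$ for $n\ge1$, where $\{\chi_i^{(n)}: i,n\ge1\}$ are independent with $\mathbb{P}(\chi_i^{(n)}=k)=q_n(k)$. Write $f_n(s)=\sum_{k\ge0}s^kq_n(k)$, $s\in[0,1]$; derivatives at $1$ are left derivatives, i.e. $f_n'(1)=\mathbb{E}[\chi_i^{(n)}]$, $f_n''(1)=\mathbb{E}[\chi_i^{(n)}(\chi_i^{(n)}-1)]$, $f_n'''(1)=\mathbb{E}[\chi_i^{(n)}(\chi_i^{(n)}-1)(\chi_i^{(n)}-2)]$. It is assumed that $0<f_n'(1)<\infty$ and $f_n''(1)<\infty$ for all $n\ge 1$. Set $\mu_0=1$, $\mu_n=f_1'(1)\cdots f_n'(1)$ and $\nu_n=f_n''(1)/f_n'(1)^2$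 for $n\ge1$. Set $a_0^Q=1$ and $a_n^Q=\frac{\mu_n}{2}\sum_{k=0}^{n-1}\frac{\nu_{k+1}}{\mu_k}$ for $n\ge1$. The GWVE is regular if there is $c>0$ such that for all $n\ge1$, $\mathbb{E}[(\chi_i^{(n)})^2\mathbf 1_{\{\chi_i^{(n)}\ge2\}}]\le c\,\mathbb{E}[\chi_i^{(n)}\mathbf 1_{\{\chi_i^{(n)}\ge2\}}]\,\mathbb{E}[\chi_i^{(n)}\mid\chi_i^{(n)}\ge1]$. A regular GWVE is critical if $\sum_{k=0}^\infty\frac{\nu_{k+1}}{\mu_k}=\infty$ and $\lim_{n\to\infty}\mu_n\sum_{k=0}^{n-1}\frac{\nu_{k+1}}{\mu_k}=\infty$. *)

theory Defs
  imports "HOL-Probability.Probability"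
begin

(* An environment is a sequence q of laws on the natural numbers indexed from 1: q n is the
   offspring law of generation n - 1, and q 0 is never used. *)

definition gf :: "nat pmf \<Rightarrow> real \<Rightarrow> real" where
  "gf p s = (\<Sum>k. s ^ k * pmf p k)"

(* The j-th derivative of gf p at 1 from the left, as an extended nonnegative number, so that
   finiteness and inequalities are meaningful without integrability assumptions: it is the
   factorial moment E[X (X - 1) ... (X - j + 1)] of X distributed as p.  The subtraction is
   truncated, which is harmless because the product contains the factor 0 whenever k < j.
   gf_deriv_tendsto below confirms the reading as a derivative. *)
definition gf_deriv1 :: "nat \<Rightarrow> nat pmf \<Rightarrow> ennreal" where
  "gf_deriv1 j p = (\<integral>\<^sup>+ k. of_nat (\<Prod>i<j. k - i) \<partial>measure_pmf p)"

definition varying_env :: "(nat \<Rightarrow> nat pmf) \<Rightarrow> bool" where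
  "varying_env q \<longleftrightarrow>
     (\<forall>n\<ge>1. 0 < gf_deriv1 1 (q n) \<and> gf_deriv1 1 (q n) < \<infinity> \<and> gf_deriv1 2 (q n) < \<infinity>)"

definition env_mu :: "(nat \<Rightarrow> nat pmf) \<Rightarrow> nat \<Rightarrow> real" where
  "env_mu q n = (\<Prod>k=1..n. enn2real (gf_deriv1 1 (q k)))"

definition env_nu :: "(nat \<Rightarrow> nat pmf) \<Rightarrow> nat \<Rightarrow> real" where
  "env_nu q n = enn2real (gf_deriv1 2 (q n)) / (enn2real (gf_deriv1 1 (q n)))\<^sup>2"

definition env_a :: "(nat \<Rightarrow> nat pmf) \<Rightarrow> nat \<Rightarrow> real" where
  "env_a q n =
     (if n = 0 then 1 else env_mu q n / 2 * (\<Sum>k<n. env_nu q (Suc k) / env_mu q k))"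

(* Under varying_env the expectations below are finite and the event {1..} has positive
   probability, so that cond_pmf is the conditional law. *)
definition regular_env :: "(nat \<Rightarrow> nat pmf) \<Rightarrow> bool" where
  "regular_env q \<longleftrightarrow> varying_env q \<and>
     (\<exists>c>0. \<forall>n\<ge>1.
        measure_pmf.expectation (q n) (\<lambda>k. (real k)\<^sup>2 * indicator {2..} k)
        \<le> c * measure_pmf.expectation (q n) (\<lambda>k. real k * indicator {2..} k)
            * measure_pmf.expectation (cond_pmf (q n) {1..}) real)"

definition critical_env :: "(nat \<Rightarrow> nat pmf) \<Rightarrow> bool" where
  "critical_env q \<longleftrightarrow> regular_env q \<and>
     filterlim (\<lambda>n. \<Sum>k<n. env_nu q (Suc k) / env_mu q k) at_top sequentially \<and>
     filterlim (\<lambda>n. env_mu q n * (\<Sum>k<n. env_nu q (Suc k) / env_mu q k)) at_top sequentially"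

(* chi n i is the number of children of the i-th individual of generation n - 1. *)
definition offspring_family ::
    "'a measure \<Rightarrow> (nat \<Rightarrow> nat pmf) \<Rightarrow> (nat \<Rightarrow> nat \<Rightarrow> 'a \<Rightarrow> nat) \<Rightarrow> bool" where
  "offspring_family M q chi \<longleftrightarrow> prob_space M \<and>
     prob_space.indep_vars M (\<lambda>_. count_space UNIV) (\<lambda>(n, i). chi n i) ({1..} \<times> {1..}) \<and>
     (\<forall>n\<ge>1. \<forall>i\<ge>1. \<forall>k. measure M {\<omega> \<in> space M. chi n i \<omega> = k} = pmf (q n) k)"

primrec gw :: "(nat \<Rightarrow> nat \<Rightarrow> 'a \<Rightarrow> nat) \<Rightarrow> nat \<Rightarrow> 'a \<Rightarrow> nat" where
  "gw chi 0 \<omega> = 1"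
| "gw chi (Suc n) \<omega> = (\<Sum>i=1..gw chi n \<omega>. chi (Suc n) i \<omega>)"

lemma iterated_deriv_power_series:
  fixes c :: "nat \<Rightarrow> real"
  assumes "\<And>x. \<bar>x\<bar> < 1 \<Longrightarrow> summable (\<lambda>n. c n * x ^ n)"
  shows "\<forall>s. \<bar>s\<bar> < 1 \<longrightarrow>
           summable (\<lambda>n. (diffs ^^ j) c n * s ^ n) \<and>
           (deriv ^^ j) (\<lambda>x. \<Sum>n. c n * x ^ n) s = (\<Sum>n. (diffs ^^ j) c n * s ^ n)"
proof (induction j)
  case 0 then show ?case using assms by simp
next
  case (Suc j)
  let ?d = "(diffs ^^ j) c"
  show ?case
  proof (intro allI impI conjI)
    fix s :: real assume s: "\<bar>s\<bar> < 1"
    have sm: "summable (\<lambda>n. ?d n * z ^ n)" if "norm z < 1" for z :: real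
      using Suc that by simp
    show "summable (\<lambda>n. (diffs ^^ Suc j) c n * s ^ n)"
      using termdiff_converges[of s 1 ?d] sm s by simp
    have "((\<lambda>x. \<Sum>n. ?d n * x ^ n) has_field_derivative (\<Sum>n. diffs ?d n * s ^ n)) (at s)"
      using termdiffs_strong'[of 1 ?d s] sm s by simp
    moreover have "eventually (\<lambda>x. (deriv ^^ j) (\<lambda>x. \<Sum>n. c n * x ^ n) x = (\<Sum>n. ?d n * x ^ n)) (nhds s)"
    proof -
      have "eventually (\<lambda>x. x \<in> {-1<..<1}) (nhds s)"
        using s by (intro eventually_nhds_in_open) auto
      then show ?thesis
        by (rule eventually_mono) (use Suc in auto)
    qed
    ultimately show "(deriv ^^ Suc j) (\<lambda>x. \<Sum>n. c n * x ^ n) s = (\<Sum>n. (diffs ^^ Suc j) c n * s ^ n)"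
      by (simp add: DERIV_imp_deriv deriv_cong_ev)
  qed
qed

lemma diffs_iterated: "(diffs ^^ j) c n = real (\<Prod>i<j. n + j - i) * (c (n + j) :: real)"
proof (induction j arbitrary: n)
  case 0 then show ?case by simp
next
  case (Suc j)
  have "(\<Prod>i<Suc j. n + Suc j - i) = (n + Suc j) * (\<Prod>i<j. n + j - i)"
    by (subst prod.lessThan_Suc_shift) simp
  have e: "(\<Prod>i<Suc j. n + Suc j - i) = Suc n * (\<Prod>i<j. Suc n + j - i)"
    by (simp add: ac_simps)
  show ?case unfolding e funpow.simps comp_apply diffs_def[of "(diffs ^^ j) c"] Suc of_nat_mult
    by (simp only: mult.assoc add_Suc add_Suc_right)
qed

lemma gf_deriv_tendsto:
  "((\<lambda>s. ennreal ((deriv ^^ j) (gf p) s)) \<longlongrightarrow> gf_deriv1 j p) (at_left 1)"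
proof -
  define d where "d = (diffs ^^ j) (pmf p)"
  have d0: "d n \<ge> 0" for n unfolding d_def diffs_iterated
    by (intro mult_nonneg_nonneg) (simp_all del: of_nat_prod)
  have sp: "summable (\<lambda>n. pmf p n * x ^ n)" if "\<bar>x\<bar> < 1" for x :: real
  proof (rule summable_comparison_test')
    show "summable (\<lambda>n. \<bar>x\<bar> ^ n)" using that by (simp add: summable_geometric)
    show "norm (pmf p n * x ^ n) \<le> \<bar>x\<bar> ^ n" if "n \<ge> 0" for n
      by (simp add: abs_mult power_abs mult_left_le_one_le pmf_le_1)
  qed
  have gf: "gf p = (\<lambda>x. \<Sum>n. pmf p n * x ^ n)" by (simp add: gf_def fun_eq_iff mult.commute)
  have it: "summable (\<lambda>n. d n * s ^ n)" "(deriv ^^ j) (gf p) s = (\<Sum>n. d n * s ^ n)" if "\<bar>s\<bar> < 1" for s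
    using iterated_deriv_power_series[OF sp] that unfolding d_def gf by auto
  have D: "ennreal ((deriv ^^ j) (gf p) s) = (\<Sum>n. ennreal (d n * s ^ n))" if "0 \<le> s" "s < 1" for s
    using it[of s] that d0 by (subst suminf_ennreal2) auto
  have G: "gf_deriv1 j p = (\<Sum>n. ennreal (d n))"
  proof -
    let ?f = "\<lambda>k. ennreal (pmf p k * real (\<Prod>i<j. k - i))"
    have z: "?f k = 0" if "k < j" for k
    proof -
      have "(\<Prod>i<j. k - i) = 0" using that by (intro prod_zero bexI[of _ k]) auto
      then show ?thesis by (simp del: of_nat_prod)
    qed
    have "gf_deriv1 j p = (\<Sum>k. ?f k)"
      unfolding gf_deriv1_def
      by (simp add: nn_integral_measure_pmf nn_integral_count_space_nat ennreal_mult' ennreal_of_nat_eq_real_of_nat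
        del: of_nat_prod)
    also have "\<dots> = (\<Sum>k. ?f (k + j))"
    proof -
      have "(\<Sum>k<j. ?f k) = 0" by (intro sum.neutral ballI z) simp
      then show ?thesis using suminf_offset[OF summableI, of ?f j] by (simp only: add_0_right)
    qed
    finally show ?thesis unfolding d_def diffs_iterated by (simp add: mult.commute del: of_nat_prod)
  qed
  have ev: "eventually (\<lambda>s::real. 0 < s \<and> s < 1) (at_left 1)"
    using eventually_at_left_real[of 0 1] by simp
  show ?thesis
  proof (rule order_tendstoI)
    fix a assume "a < gf_deriv1 j p"
    then obtain N where "a < (\<Sum>n<N. ennreal (d n))"
      unfolding G suminf_eq_SUP less_SUP_iff by auto
    then have N: "a < ennreal (\<Sum>n<N. d n)" using d0 by simp
    have "((\<lambda>s. \<Sum>n<N. d n * s ^ n) \<longlongrightarrow> (\<Sum>n<N. d n * 1 ^ n)) (at_left 1)"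
      by (intro tendsto_intros)
    then have "((\<lambda>s. ennreal (\<Sum>n<N. d n * s ^ n)) \<longlongrightarrow> ennreal (\<Sum>n<N. d n)) (at_left 1)"
      by (intro tendsto_ennrealI) simp
    from order_tendstoD(1)[OF this N] ev
    show "\<forall>\<^sub>F s in at_left 1. a < ennreal ((deriv ^^ j) (gf p) s)"
    proof eventually_elim
      case (elim s)
      have "ennreal (\<Sum>n<N. d n * s ^ n) \<le> ennreal ((deriv ^^ j) (gf p) s)"
        using it[of s] elim d0 by (auto intro!: ennreal_leI sum_le_suminf)
      with elim show ?case by simp
    qed
  next
    fix a assume a: "gf_deriv1 j p < a"
    from ev show "\<forall>\<^sub>F s in at_left 1. ennreal ((deriv ^^ j) (gf p) s) < a"
    proof eventually_elim
      case (elim s)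
      have "d n * s ^ n \<le> d n" for n
        using elim d0[of n] by (intro mult_right_le_one_le power_le_one) auto
      then have "(\<Sum>n. ennreal (d n * s ^ n)) \<le> (\<Sum>n. ennreal (d n))"
        by (intro suminf_le ennreal_leI summableI)
      then have "ennreal ((deriv ^^ j) (gf p) s) \<le> gf_deriv1 j p"
        using elim D[of s] G by simp
      with a show ?case by simp
    qed
  qed
qed

end

theory Submission
  imports Defs "HOL-Real_Asymp.Real_Asymp"
begin

text \<open>The proof follows Kersting's shape function method.  Let every member of generation \<open>n\<close> be
marked independently with probability \<open>x\<close>, and let \<open>thin q n x\<close> be the probability
that some member is marked.  Then the conditional Laplace transform of \<open>Z / a\<close> at
\<open>j\<close> is \<open>1 - thin q n (1 - exp (- j / a)) / thin q n 1\<close>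
(\<open>conditional_power\<close>), so everything depends on the asymptotics of \<open>thin\<close>, uniformly
in \<open>x\<close>.

For one offspring law with mean \<open>m\<close> and second factorial moment \<open>b\<close>, the difference
between \<open>1 / alive p x\<close> and its linear-fractional leading term \<open>1 / (m * x)\<close> is the
bounded function \<open>shape p x\<close>.  Hence along the composition that defines \<open>thin\<close> the
reciprocals add up, and \<open>1 / thin q n x\<close> is \<open>1 / (\<mu> n * x)\<close> plus a weighted sum of
values of \<open>shape\<close>.  If each of these is replaced by its limit \<open>b / (2 * m\<^sup>2)\<close>, the sum
becomes \<open>S n / 2\<close>, where \<open>S n\<close> is the sum of all \<open>\<nu> (k + 1) / \<mu> k\<close> for
\<open>k < n\<close>.

That this replacement costs only \<open>o(S n)\<close> is the heart of the matter
(\<open>thin_asymptotics\<close>, resting on \<open>partial_sums_close\<close>).  Regularity bounds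
\<open>shape\<close> from below by a multiple of \<open>b / m\<^sup>2\<close> (\<open>shape_ge_regular\<close>), and so
bounds the survival probability from generation \<open>k\<close> to \<open>n\<close> from above by a multiple of
\<open>1 / (\<mu> k * (S n - S k))\<close>.  The third moment condition bounds the error at generation
\<open>k\<close> in terms of that survival probability (\<open>shape_near\<close>), and also each single
summand of \<open>S\<close> by reciprocals of \<open>\<mu>\<close> (\<open>second_le_mean\<close>); criticality
says that these reciprocals are \<open>o(S)\<close>.  So the error is relatively small in all generations but the
last ones, and these contribute little to \<open>S n\<close>.

It follows that \<open>1 / thin q n x\<close> is close to \<open>1 / (\<mu> n * x) + S n / 2\<close>, with
\<open>S n / 2 = a / \<mu> n\<close>.  For \<open>x = 1\<close> the first term is negligible; for
\<open>x = 1 - exp (- j / a)\<close> it is asymptotically \<open>S n / (2 * j)\<close>.  The conditional Laplace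
transform at each integer \<open>j\<close> therefore tends to \<open>1 / (1 + j)\<close>, that of the standard
exponential law, and by Weierstrass approximation Laplace transforms at integers determine weak
convergence on the half-line (\<open>laplace_transforms_imp_weak_conv\<close>).\<close>

section \<open>Integrals under a conditional law\<close>

lemma (in prob_space) integral_uniform_measure:
  fixes f :: "'a \<Rightarrow> real"
  assumes A: "A \<in> events" "prob A > 0" and f: "integrable M f" "\<And>x. 0 \<le> f x"
  shows "integral\<^sup>L (uniform_measure M A) f = expectation (\<lambda>x. f x * indicator A x) / prob A"
proof -
  have "integral\<^sup>L (uniform_measure M A) f = enn2real (\<integral>\<^sup>+x. ennreal (f x) \<partial>uniform_measure M A)"
    using f by (subst integral_eq_nn_integral) auto
  also have "(\<integral>\<^sup>+x. ennreal (f x) \<partial>uniform_measure M A)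
      = (\<integral>\<^sup>+x. ennreal (f x) * indicator A x \<partial>M) / emeasure M A"
    using A f by (subst nn_integral_uniform_measure) auto
  also have "(\<integral>\<^sup>+x. ennreal (f x) * indicator A x \<partial>M) = (\<integral>\<^sup>+x. ennreal (f x * indicator A x) \<partial>M)"
    by (intro nn_integral_cong) (auto simp: indicator_def)
  also have "\<dots> = ennreal (expectation (\<lambda>x. f x * indicator A x))"
    using f A integrable_real_mult_indicator[OF A(1) f(1)] by (intro nn_integral_eq_integral) auto
  also have "\<dots> / emeasure M A = ennreal (expectation (\<lambda>x. f x * indicator A x) / prob A)"
    using A f by (simp add: emeasure_eq_measure divide_ennreal)
  finally show ?thesis using A f by simp
qed

section \<open>Inequalities for powers of 1 - x\<close>

text \<open>Bernoulli's inequality for \<open>1 + x\<close>, multiplied by \<open>(1 - x) ^ j\<close>.  In this form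
convexity enters both bounds below that hold uniformly in \<open>x\<close>.\<close>

lemma power_mult_Bernoulli_le_1:
  fixes x :: real
  assumes "0 \<le> x" "x \<le> 1"
  shows "(1 - x) ^ j * (1 + real j * x) \<le> 1"
proof -
  have "(1 - x) ^ j * (1 + real j * x) \<le> (1 - x) ^ j * (1 + x) ^ j"
    using assms by (intro mult_left_mono Bernoulli_inequality) auto
  also have "\<dots> = (1 - x\<^sup>2) ^ j"
    by (simp add: power_mult_distrib[symmetric] algebra_simps power2_eq_square)
  also have "\<dots> \<le> 1" using assms by (intro power_le_one) (auto simp: power_le_one)
  finally show ?thesis .
qed

lemma one_minus_power_le:
  fixes x :: real
  assumes "0 \<le> x" "x \<le> 1"
  shows "1 - (1 - x) ^ k \<le> real k * x"
  using Bernoulli_inequality[of "-x" k] assms by simp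

text \<open>The next two lemmas are the Bonferroni inequalities of second and third order; taking expectations
turns them into Taylor bounds for \<open>alive\<close> in terms of factorial moments.\<close>

lemma one_minus_power_Bonferroni_lower:
  fixes x :: real
  assumes "0 \<le> x" "x \<le> 1"
  shows "real k * x - real k * (real k - 1) * x\<^sup>2 / 2 \<le> 1 - (1 - x) ^ k"
proof (induction k)
  case (Suc k)
  have "x * (1 - (1 - x) ^ k) \<le> x * (real k * x)"
    using one_minus_power_le[OF assms, of k] assms by (intro mult_left_mono) auto
  then show ?case using Suc by (simp add: field_simps power2_eq_square)
qed simp

lemma one_minus_power_Bonferroni_upper:
  fixes x :: real
  assumes "0 \<le> x" "x \<le> 1"
  shows "1 - (1 - x) ^ k \<le> real k * x - real k * (real k - 1) * x\<^sup>2 / 2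
           + real k * (real k - 1) * (real k - 2) * x ^ 3 / 6"
proof (induction k)
  case (Suc k)
  have "x * (real k * x - real k * (real k - 1) * x\<^sup>2 / 2) \<le> x * (1 - (1 - x) ^ k)"
    using one_minus_power_Bonferroni_lower[OF assms, of k] assms by (intro mult_left_mono) auto
  then show ?case using Suc by (simp add: field_simps power2_eq_square power3_eq_cube)
qed simp

text \<open>With \<open>c = 1 + (k - 1) * x\<close> one has \<open>k * x / c \<le> 1 - (1 - x) ^ k\<close>.
Replacing \<open>1 / c\<close> by its tangent at \<open>\<tau>\<close> makes the bound quadratic in
\<open>k\<close>, so that it can be integrated; a good choice of \<open>\<tau>\<close> then loses nothing
compared with the Cauchy--Schwarz inequality.\<close>

lemma one_minus_power_tangent:
  fixes x \<tau> :: real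
  assumes "0 < x" "x \<le> 1" "0 < \<tau>"
  shows "real k * x * (2 / \<tau> - (1 + (real k - 1) * x) / \<tau>\<^sup>2) \<le> 1 - (1 - x) ^ k"
proof (cases k)
  case (Suc j)
  define c where "c = 1 + real j * x"
  have c: "c > 0" using assms unfolding c_def by (intro add_pos_nonneg) auto
  have "2 / \<tau> - c / \<tau>\<^sup>2 \<le> 1 / c"
  proof -
    have "0 \<le> (1 / c) * (1 - c / \<tau>)\<^sup>2" using c by simp
    also have "\<dots> = 1 / c - (2 / \<tau> - c / \<tau>\<^sup>2)"
      using c assms by (simp add: power2_eq_square field_simps)
    finally show ?thesis by simp
  qed
  then have "real k * x * (2 / \<tau> - c / \<tau>\<^sup>2) \<le> real k * x * (1 / c)"
    using assms by (intro mult_left_mono) auto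
  also have "\<dots> \<le> 1 - (1 - x) ^ k"
  proof -
    have "(1 - x) * ((1 - x) ^ j * c) \<le> (1 - x) * 1"
      unfolding c_def using assms power_mult_Bernoulli_le_1[of x j] by (intro mult_left_mono) auto
    then have "real k * x \<le> (1 - (1 - x) ^ k) * c"
      unfolding Suc by (simp add: c_def algebra_simps)
    then show ?thesis using c by (simp add: field_simps)
  qed
  finally show ?thesis by (simp add: Suc c_def)
qed simp

text \<open>Write \<open>u k = 1 - (1 - x) ^ k\<close>.  Then \<open>k * x - u k\<close> is \<open>x\<close> times the sum of
\<open>u j\<close> over \<open>j < k\<close>, and since \<open>u\<close> is concave with \<open>u 0 = 0\<close>, that
sum is at least the area \<open>(k - 1) * u k / 2\<close> of a triangle.\<close>

lemma one_minus_power_curvature: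
  fixes x :: real
  assumes "0 \<le> x" "x \<le> 1"
  shows "x * ((real k - indicator {0<..} k) * (1 - (1 - x) ^ k)) \<le> 2 * (real k * x - (1 - (1 - x) ^ k))"
proof -
  have *: "x * (real j * (1 - (1 - x) ^ Suc j)) \<le> 2 * (real (Suc j) * x - (1 - (1 - x) ^ Suc j))" for j
  proof (induction j)
    case (Suc j)
    have "x * ((1 - x) ^ Suc j * (1 + real (Suc j) * x)) \<le> x * 1"
      using assms power_mult_Bernoulli_le_1[of x "Suc j"] by (intro mult_left_mono) auto
    then show ?case using Suc by (simp add: algebra_simps)
  qed simp
  show ?thesis
  proof (cases k)
    case (Suc j) then show ?thesis using *[of j] by simp
  qed simp
qed

section \<open>The shape function of one offspring law\<close>

abbreviation fmoment :: "nat \<Rightarrow> nat pmf \<Rightarrow> real" where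
  "fmoment j p \<equiv> enn2real (gf_deriv1 j p)"

definition mean :: "nat pmf \<Rightarrow> real" where "mean p = fmoment 1 p"

definition fmoment2 :: "nat pmf \<Rightarrow> real" where "fmoment2 p = fmoment 2 p"

definition fmoment3 :: "nat pmf \<Rightarrow> real" where "fmoment3 p = fmoment 3 p"

text \<open>The generating function is used in the variable \<open>x = 1 - s\<close>: if every child is marked
independently with probability \<open>x\<close>, then \<open>alive p x\<close> is the probability that at
least one child is marked.\<close>

definition alive :: "nat pmf \<Rightarrow> real \<Rightarrow> real" where
  "alive p x = measure_pmf.expectation p (\<lambda>k. 1 - (1 - x) ^ k)"

text \<open>Kersting's shape function.  Subtracting the linear-fractional leading term from
\<open>1 / alive p x\<close> leaves a bounded function, whose limit as \<open>x\<close> tends to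
\<open>0\<close> is half the normalised second factorial moment.\<close>

definition shape :: "nat pmf \<Rightarrow> real \<Rightarrow> real" where
  "shape p x = 1 / alive p x - 1 / (mean p * x)"

lemma expectation_power: "0 \<le> s \<Longrightarrow> s \<le> 1 \<Longrightarrow> measure_pmf.expectation p (\<lambda>k. s ^ k) = 1 - alive p (1 - s)"
proof -
  assume s: "0 \<le> s" "s \<le> (1::real)"
  have "integrable (measure_pmf p) (\<lambda>k. s ^ k)"
    by (rule measure_pmf.integrable_const_bound[where B = 1]) (use s in \<open>auto intro: power_le_one\<close>)
  then show ?thesis unfolding alive_def by simp
qed

lemma alive_bounds:
  assumes "0 \<le> x" "x \<le> 1"
  shows "0 \<le> alive p x" "alive p x \<le> 1"
proof -
  have 0: "0 \<le> (1 - x) ^ k" "(1 - x) ^ k \<le> 1" for k using assms by (auto intro: power_le_one)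
  have "integrable (measure_pmf p) (\<lambda>k. 1 - (1 - x) ^ k)"
    by (rule measure_pmf.integrable_const_bound[where B = 1]) (use 0 in auto)
  moreover from this have "alive p x \<le> measure_pmf.expectation p (\<lambda>_. 1)"
    unfolding alive_def using 0 by (intro integral_mono) auto
  ultimately show "0 \<le> alive p x" "alive p x \<le> 1"
    unfolding alive_def using 0 by (auto intro!: integral_nonneg_AE)
qed

lemma
  assumes "gf_deriv1 j p < \<infinity>"
  shows integrable_falling: "integrable (measure_pmf p) (\<lambda>k. real (\<Prod>i<j. k - i))"
    and fmoment_expectation: "fmoment j p = measure_pmf.expectation p (\<lambda>k. real (\<Prod>i<j. k - i))"
proof -
  have *: "gf_deriv1 j p = (\<integral>\<^sup>+ k. ennreal (real (\<Prod>i<j. k - i)) \<partial>measure_pmf p)"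
    unfolding gf_deriv1_def by (simp add: ennreal_of_nat_eq_real_of_nat del: of_nat_prod)
  show "integrable (measure_pmf p) (\<lambda>k. real (\<Prod>i<j. k - i))"
    by (intro integrableI_nonneg) (use assms * in \<open>auto simp del: of_nat_prod\<close>)
  show "fmoment j p = measure_pmf.expectation p (\<lambda>k. real (\<Prod>i<j. k - i))"
    unfolding * by (subst integral_eq_nn_integral) (auto simp del: of_nat_prod)
qed

lemma falling_1: "real (\<Prod>i<1. k - i) = real k"
  by simp

lemma falling_2: "real (\<Prod>i<2. k - i) = real k * (real k - 1)"
  by (cases k) (simp_all add: numeral_2_eq_2 algebra_simps)

lemma falling_3: "real (\<Prod>i<3. k - i) = real k * (real k - 1) * (real k - 2)"
proof -
  have "k = 0 \<or> k = 1 \<or> k \<ge> 2" by linarith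
  then show ?thesis by (auto simp: numeral_3_eq_3 of_nat_diff)
qed

locale offspring_law =
  fixes p :: "nat pmf"
  assumes mean_pos: "0 < gf_deriv1 1 p" and mean_finite: "gf_deriv1 1 p < \<infinity>"
    and second_finite: "gf_deriv1 2 p < \<infinity>"
begin

abbreviation m :: real where "m \<equiv> mean p"
abbreviation b :: real where "b \<equiv> fmoment2 p"
abbreviation P :: real where "P \<equiv> measure_pmf.prob p {0<..}"
abbreviation E :: "(nat \<Rightarrow> real) \<Rightarrow> real" where "E \<equiv> measure_pmf.expectation p"

lemma integrable_id [simp]: "integrable (measure_pmf p) real"
  using integrable_falling[OF mean_finite] unfolding falling_1 mean_def .

lemma mean_eq: "m = E real"
  using fmoment_expectation[OF mean_finite] unfolding falling_1 mean_def .

lemma integrable_fall2 [simp]: "integrable (measure_pmf p) (\<lambda>k. real k * (real k - 1))"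
  using integrable_falling[OF second_finite] unfolding falling_2 fmoment2_def .

lemma second_eq: "b = E (\<lambda>k. real k * (real k - 1))"
  using fmoment_expectation[OF second_finite] unfolding falling_2 fmoment2_def .

lemma m_pos: "0 < m"
  unfolding mean_def using mean_pos mean_finite by (simp add: enn2real_positive_iff)

lemma b_nonneg [simp]: "0 \<le> b"
  by (simp add: fmoment2_def)

lemma integrable_ind [simp]: "integrable (measure_pmf p) (indicator {0<..} :: nat \<Rightarrow> real)"
  by (rule measure_pmf.integrable_const_bound[where B = 1]) (auto simp: indicator_def)

lemma P_eq: "P = E (indicator {0<..})"
  by simp

lemma P_pos: "0 < P"
proof (rule ccontr)
  assume "\<not> 0 < P"
  then have "set_pmf p \<inter> {0<..} = {}"
    by (simp add: measure_pmf_zero_iff[symmetric] zero_less_measure_iff)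
  then have "E real = E (\<lambda>_. 0)"
    by (intro integral_cong_AE) (auto simp: AE_measure_pmf_iff Suc_le_eq)
  then show False using m_pos mean_eq by simp
qed

lemma P_le_m: "P \<le> m"
  unfolding P_eq mean_eq by (intro integral_mono) (auto simp: indicator_def)

context
  fixes x :: real
  assumes x: "0 < x" "x \<le> 1"
begin

lemma power_le: "(1 - x) ^ k \<le> 1" "0 \<le> (1 - x) ^ k"
  using x by (auto intro: power_le_one)

lemma integrable_alive [simp]: "integrable (measure_pmf p) (\<lambda>k. 1 - (1 - x) ^ k)"
  by (rule measure_pmf.integrable_const_bound[where B = 1]) (use power_le in auto)

lemma alive_le_mean: "alive p x \<le> m * x"
proof -
  have "alive p x \<le> E (\<lambda>k. real k * x)"
    unfolding alive_def using x by (intro integral_mono one_minus_power_le) auto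
  then show ?thesis by (simp add: mean_eq)
qed

lemma alive_ge_P: "P * x \<le> alive p x"
proof -
  have "E (\<lambda>k. indicator {0<..} k * x) \<le> alive p x"
    unfolding alive_def
  proof (intro integral_mono)
    show "indicator {0<..} k * x \<le> 1 - (1 - x) ^ k" for k
    proof (cases k)
      case (Suc j)
      have "(1 - x) * (1 - x) ^ j \<le> (1 - x) * 1" using x power_le by (intro mult_left_mono) auto
      then show ?thesis using Suc by simp
    qed simp
  qed auto
  then show ?thesis by simp
qed

lemma alive_pos: "0 < alive p x"
  using alive_ge_P P_pos x by (smt (verit) mult_pos_pos)

lemma shape_eq: "shape p x = (m * x - alive p x) / (m * x * alive p x)"
  unfolding shape_def using alive_pos m_pos x by (simp add: field_simps)

text \<open>The quadratic bound \<open>one_minus_power_tangent\<close>, integrated, gives \<open>m * x / \<tau> \<le> alive p x\<close> when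
\<open>\<tau>\<close> is the size-biased mean of \<open>1 + (k - 1) * x\<close>.\<close>

lemma shape_le: "shape p x \<le> b / m\<^sup>2"
proof -
  define \<tau> where "\<tau> = 1 + b * x / m"
  have \<tau>: "\<tau> > 0" unfolding \<tau>_def using b_nonneg m_pos x by (intro add_pos_nonneg) auto
  have "E (\<lambda>k. real k * x * (2 / \<tau> - (1 + (real k - 1) * x) / \<tau>\<^sup>2)) \<le> alive p x"
    (is "E ?f \<le> _")
    unfolding alive_def
  proof (intro integral_mono one_minus_power_tangent)
    have "?f = (\<lambda>k. (2 * x / \<tau> - x / \<tau>\<^sup>2) * real k - x\<^sup>2 / \<tau>\<^sup>2 * (real k * (real k - 1)))"
      by (auto simp: fun_eq_iff algebra_simps power2_eq_square add_divide_distrib diff_divide_distrib)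
    then show "integrable (measure_pmf p) ?f" by simp
  qed (use x \<tau> in auto)
  also have "E ?f = E (\<lambda>k. (2 * x / \<tau> - x / \<tau>\<^sup>2) * real k - x\<^sup>2 / \<tau>\<^sup>2 * (real k * (real k - 1)))"
    by (intro Bochner_Integration.integral_cong)
      (auto simp: algebra_simps power2_eq_square add_divide_distrib diff_divide_distrib)
  also have "\<dots> = (2 * x / \<tau> - x / \<tau>\<^sup>2) * m - x\<^sup>2 / \<tau>\<^sup>2 * b"
    by (simp add: mean_eq second_eq)
  also have "\<dots> = 2 * m * x / \<tau> - x * (m + b * x) / \<tau>\<^sup>2"
    by (simp add: algebra_simps power2_eq_square add_divide_distrib)
  also have "m + b * x = m * \<tau>"
    unfolding \<tau>_def using m_pos by (simp add: field_simps)
  also have "2 * m * x / \<tau> - x * (m * \<tau>) / \<tau>\<^sup>2 = m * x / \<tau>"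
    using \<tau> by (simp add: field_simps power2_eq_square)
  finally have "m * x / \<tau> \<le> alive p x" .
  then have "1 / alive p x \<le> 1 / (m * x / \<tau>)"
    using m_pos x \<tau> by (intro divide_left_mono mult_pos_pos alive_pos) auto
  also have "\<dots> = 1 / (m * x) + b / m\<^sup>2"
    unfolding \<tau>_def using m_pos x by (simp add: field_simps power2_eq_square)
  finally show ?thesis unfolding shape_def by simp
qed

text \<open>Chebyshev's correlation inequality on the event of having a child: both \<open>k - 1\<close> and
\<open>1 - (1 - x) ^ k\<close> increase with \<open>k\<close>.  Instead of a second independent copy, the
proof compares with the value of the latter at the integer \<open>K\<close> where \<open>k - 1\<close>
crosses its own conditional mean \<open>a\<close>.\<close>

lemma alive_excess_le:
  "alive p x * (m - P) \<le> P * E (\<lambda>k. (real k - indicator {0<..} k) * (1 - (1 - x) ^ k))"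
proof -
  let ?u = "\<lambda>k::nat. 1 - (1 - x) ^ k"
  define a where "a = (m - P) / P"
  have a0: "a \<ge> 0" unfolding a_def using P_le_m P_pos by simp
  define K where "K = Suc (nat \<lfloor>a\<rfloor>)"
  have K: "a < real K" "real K - 1 \<le> a"
    unfolding K_def using a0 by linarith+
  let ?A = "\<lambda>k. real k - indicator {0<..} k"
  have int: "integrable (measure_pmf p) (\<lambda>k. ?A k * ?u k)"
    by (rule Bochner_Integration.integrable_bound[OF integrable_id])
      (use power_le in \<open>auto simp: indicator_def abs_mult intro!: mult_mono[of _ "real _" _ 1, simplified]\<close>)
  have pw: "?u K * (?A k - a * indicator {0<..} k) \<le> ?A k * ?u k - a * ?u k" for k
  proof (cases "k = 0")
    case False
    have "0 \<le> (real k - 1 - a) * (?u k - ?u K)"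
    proof (cases "k \<le> K")
      case True
      then have "real k - 1 - a \<le> 0" using K by linarith
      moreover have "?u k \<le> ?u K" using True x by (simp add: power_decreasing)
      ultimately show ?thesis by (simp add: mult_nonpos_nonpos)
    next
      case F: False
      then have "real k - 1 \<ge> real K" by linarith
      then have "0 \<le> real k - 1 - a" using K by linarith
      moreover have "?u K \<le> ?u k" using F x by (simp add: power_decreasing)
      ultimately show ?thesis by simp
    qed
    then show ?thesis using False by (simp add: algebra_simps)
  qed simp
  have "0 = ?u K * (m - P - a * P)" unfolding a_def using P_pos by simp
  also have "\<dots> = E (\<lambda>k. ?u K * (?A k - a * indicator {0<..} k))"
    by (simp add: mean_eq)
  also have "\<dots> \<le> E (\<lambda>k. ?A k * ?u k - a * ?u k)"
    by (intro integral_mono pw) (use int in auto)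
  also have "\<dots> = E (\<lambda>k. ?A k * ?u k) - a * alive p x"
    unfolding alive_def using int by simp
  finally have "P * (a * alive p x) \<le> P * E (\<lambda>k. ?A k * ?u k)"
    using P_pos by (intro mult_left_mono) auto
  then show ?thesis unfolding a_def using P_pos by (simp add: mult.commute)
qed

text \<open>A lower bound uniform in \<open>x\<close>, equal to half the value of \<open>shape\<close> at
\<open>x = 1\<close>.  The numerator of \<open>shape\<close> is the expectation of
\<open>k * x - (1 - (1 - x) ^ k)\<close>, which \<open>one_minus_power_curvature\<close> bounds from below by
a product, and the correlation inequality \<open>alive_excess_le\<close> separates the two factors.\<close>

lemma shape_ge: "(m - P) / (2 * m * P) \<le> shape p x"
proof -
  let ?A = "\<lambda>k. real k - indicator {0<..} k"
  have int: "integrable (measure_pmf p) (\<lambda>k. ?A k * (1 - (1 - x) ^ k))"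
    by (rule Bochner_Integration.integrable_bound[OF integrable_id])
      (use power_le in \<open>auto simp: indicator_def abs_mult intro!: mult_mono[of _ "real _" _ 1, simplified]\<close>)
  have "E (\<lambda>k. x * (?A k * (1 - (1 - x) ^ k))) \<le> E (\<lambda>k. 2 * (real k * x - (1 - (1 - x) ^ k)))"
  proof (intro integral_mono one_minus_power_curvature)
    show "integrable (measure_pmf p) (\<lambda>k. 2 * (real k * x - (1 - (1 - x) ^ k)))"
      by (intro integrable_mult_right Bochner_Integration.integrable_diff integrable_alive x) auto
  qed (use int x in auto)
  also have "\<dots> = 2 * (E (\<lambda>k. real k * x) - E (\<lambda>k. 1 - (1 - x) ^ k))"
    unfolding integral_mult_right_zero
    by (subst Bochner_Integration.integral_diff[OF _ integrable_alive]) auto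
  finally have "x * E (\<lambda>k. ?A k * (1 - (1 - x) ^ k)) \<le> 2 * (m * x - alive p x)"
    by (simp add: mean_eq alive_def)
  then have "P * (x * E (\<lambda>k. ?A k * (1 - (1 - x) ^ k))) \<le> P * (2 * (m * x - alive p x))"
    using P_pos by (intro mult_left_mono) auto
  moreover have "x * (alive p x * (m - P)) \<le> x * (P * E (\<lambda>k. ?A k * (1 - (1 - x) ^ k)))"
    using alive_excess_le x by (intro mult_left_mono) auto
  ultimately have "(m - P) * (x * alive p x) \<le> (m * x - alive p x) * (2 * P)"
    by (simp add: algebra_simps)
  then have "(m - P) * (m * x * alive p x) \<le> (m * x - alive p x) * (2 * m * P)"
    using mult_left_mono[of _ _ m] m_pos by (simp add: mult_ac)
  then show ?thesis unfolding shape_eq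
    using m_pos P_pos x alive_pos by (simp add: divide_le_eq le_divide_eq mult_ac)
qed

end

text \<open>This is where regularity is used: it makes the value of \<open>shape\<close> at \<open>x = 1\<close>
comparable with its limit at \<open>x = 0\<close>.\<close>

lemma second_le_regular:
  assumes "c > 0"
  and "E (\<lambda>k. (real k)\<^sup>2 * indicator {2..} k)
        \<le> c * E (\<lambda>k. real k * indicator {2..} k) * measure_pmf.expectation (cond_pmf p {1..}) real"
  shows "b / (4 * c * m\<^sup>2) \<le> (m - P) / (2 * m * P)"
proof -
  have pos: "{1..} = {0::nat<..}" by auto
  have ne: "set_pmf p \<inter> {0<..} \<noteq> {}"
    using P_pos by (metis less_irrefl measure_pmf_zero_iff)
  have cond: "measure_pmf.expectation (cond_pmf p {1..}) real = m / P"
    unfolding pos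
  proof -
    have "measure_pmf.expectation (cond_pmf p {0<..}) real
        = E (\<lambda>k. real k * indicator {0<..} k) / P"
      unfolding cond_pmf.rep_eq[OF ne]
      by (rule measure_pmf.integral_uniform_measure) (use P_pos in auto)
    also have "E (\<lambda>k. real k * indicator {0<..} k) = m"
      unfolding mean_eq by (intro Bochner_Integration.integral_cong) (auto simp: indicator_def)
    finally show "measure_pmf.expectation (cond_pmf p {0<..}) real = m / P" .
  qed
  have int2: "integrable (measure_pmf p) (\<lambda>k. (real k)\<^sup>2 * indicator {2..} k)"
  proof (rule Bochner_Integration.integrable_bound)
    show "integrable (measure_pmf p) (\<lambda>k. real k * (real k - 1) + real k)" by simp
  qed (auto simp: indicator_def power2_eq_square algebra_simps)
  have "b \<le> E (\<lambda>k. (real k)\<^sup>2 * indicator {2..} k)"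
    unfolding second_eq
  proof (intro integral_mono int2)
    fix k :: nat
    have "k = 0 \<or> k = 1 \<or> k \<ge> 2" by linarith
    then show "real k * (real k - 1) \<le> (real k)\<^sup>2 * indicator {2..} k"
      by (auto simp: power2_eq_square algebra_simps)
  qed simp
  also note assms(2)
  finally have b_le: "b \<le> c * E (\<lambda>k. real k * indicator {2..} k) * (m / P)" unfolding cond .
  have "E (\<lambda>k. real k * indicator {2..} k) \<le> E (\<lambda>k. 2 * (real k - indicator {0<..} k))"
  proof (intro integral_mono)
    show "integrable (measure_pmf p) (\<lambda>k. real k * indicator {2..} k)"
      by (rule Bochner_Integration.integrable_bound[OF integrable_id]) (auto simp: indicator_def)
    show "integrable (measure_pmf p) (\<lambda>k. 2 * (real k - indicator {0<..} k))"
      by (intro integrable_mult_right Bochner_Integration.integrable_diff) auto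
  qed (auto simp: indicator_def)
  also have "\<dots> = 2 * (m - P)" by (simp add: mean_eq)
  finally have "c * E (\<lambda>k. real k * indicator {2..} k) * (m / P) \<le> c * (2 * (m - P)) * (m / P)"
    using assms(1) m_pos P_pos by (intro mult_left_mono mult_right_mono) auto
  with b_le have "b \<le> c * (2 * (m - P)) * (m / P)" by linarith
  then show ?thesis using assms(1) m_pos P_pos
    by (simp add: field_simps power2_eq_square)
qed

lemma shape_ge_regular:
  assumes "0 < x" "x \<le> 1" "c > 0"
  and "E (\<lambda>k. (real k)\<^sup>2 * indicator {2..} k)
        \<le> c * E (\<lambda>k. real k * indicator {2..} k) * measure_pmf.expectation (cond_pmf p {1..}) real"
  shows "b / (4 * c * m\<^sup>2) \<le> shape p x"
  using second_le_regular[OF assms(3,4)] shape_ge[OF assms(1,2)] by linarith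

context
  fixes c :: real
  assumes c: "c > 0"
    and third_bound: "gf_deriv1 3 p \<le> ennreal c * gf_deriv1 2 p * (1 + gf_deriv1 1 p)"
begin

lemma third_finite: "gf_deriv1 3 p < \<infinity>"
  using third_bound by (rule order.strict_trans1)
    (use mean_finite second_finite in \<open>auto simp: ennreal_mult_less_top\<close>)

lemma third_le: "fmoment3 p \<le> c * b * (1 + m)"
  unfolding fmoment3_def mean_def fmoment2_def
proof -
  have "fmoment 3 p \<le> enn2real (ennreal c * gf_deriv1 2 p * (1 + gf_deriv1 1 p))"
    using third_bound by (rule enn2real_mono)
      (use mean_finite second_finite in \<open>auto simp: ennreal_mult_less_top\<close>)
  also have "\<dots> = c * fmoment 2 p * (1 + fmoment 1 p)"
    using c mean_finite by (simp add: enn2real_mult enn2real_plus)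
  finally show "fmoment 3 p \<le> c * fmoment 2 p * (1 + fmoment 1 p)" .
qed

lemma integrable_fall3: "integrable (measure_pmf p) (\<lambda>k. real k * (real k - 1) * (real k - 2))"
  using integrable_falling[OF third_finite] unfolding falling_3 fmoment3_def .

lemma third_eq: "fmoment3 p = E (\<lambda>k. real k * (real k - 1) * (real k - 2))"
  using fmoment_expectation[OF third_finite] unfolding falling_3 fmoment3_def .

text \<open>The law biased by the number of children has \<open>k - 1\<close> with mean \<open>b / m\<close>, and its
variance is nonnegative; the third moment bound turns this into a bound on \<open>b / m\<close> that is
linear in \<open>m\<close>.\<close>

lemma second_le_mean: "b \<le> (c + 1) * m * (1 + m)"
proof -
  define r where "r = b / m"
  have "0 \<le> E (\<lambda>k. real k * (real k - 1 - r)\<^sup>2)"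
    by (intro integral_nonneg_AE) auto
  also have "\<dots> = E (\<lambda>k. real k * (real k - 1) * (real k - 2)
        + (1 - 2 * r) * (real k * (real k - 1)) + r\<^sup>2 * real k)"
    by (intro Bochner_Integration.integral_cong) (auto simp: power2_eq_square algebra_simps)
  also have "\<dots> = fmoment3 p + (1 - 2 * r) * b + r\<^sup>2 * m"
    using integrable_fall3 by (simp add: mean_eq second_eq third_eq)
  also have "\<dots> = fmoment3 p + b - b\<^sup>2 / m"
    unfolding r_def using m_pos by (simp add: field_simps power2_eq_square)
  finally have "b\<^sup>2 / m \<le> c * b * (1 + m) + b" using third_le by linarith
  then have "b * b \<le> b * ((c * (1 + m) + 1) * m)"
    using m_pos by (simp add: field_simps power2_eq_square)
  then have "b \<le> (c * (1 + m) + 1) * m"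
    using b_nonneg m_pos c by (cases "b = 0") (auto simp: mult_le_cancel_left)
  also have "\<dots> \<le> (c * (1 + m) + 1 * (1 + m)) * m"
    using m_pos by (intro mult_right_mono add_left_mono) auto
  finally show ?thesis by (simp add: algebra_simps)
qed

text \<open>Upper estimate: by the second-order Bonferroni inequality \<open>shape\<close> is at most its
limit times \<open>m * x / alive p x\<close>, which is close to \<open>1\<close> because
\<open>shape\<close> is bounded.  Lower estimate: the third-order Bonferroni inequality and the third
moment bound.\<close>

lemma shape_near:
  assumes x: "0 < x" "x \<le> 1"
  shows "\<bar>shape p x - b / m\<^sup>2 / 2\<bar> \<le> (c + 1) * (b / m\<^sup>2) * ((1 + m) * x)"
proof -
  define g where "g = alive p x"
  have g: "g > 0" "g \<le> m * x" unfolding g_def using alive_pos[OF x] alive_le_mean[OF x] by auto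
  have lower: "m * x - b * x\<^sup>2 / 2 \<le> g"
  proof -
    have "E (\<lambda>k. real k * x - real k * (real k - 1) * x\<^sup>2 / 2) \<le> g"
      unfolding g_def alive_def using x
      by (intro integral_mono one_minus_power_Bonferroni_lower integrable_alive) auto
    then show ?thesis by (simp add: mean_eq second_eq)
  qed
  have upper: "g \<le> m * x - b * x\<^sup>2 / 2 + fmoment3 p * x ^ 3 / 6"
  proof -
    have "g \<le> E (\<lambda>k. real k * x - real k * (real k - 1) * x\<^sup>2 / 2
           + real k * (real k - 1) * (real k - 2) * x ^ 3 / 6)"
      unfolding g_def alive_def using x integrable_fall3
      by (intro integral_mono one_minus_power_Bonferroni_upper integrable_alive) auto
    then show ?thesis using integrable_fall3 by (simp add: mean_eq second_eq third_eq)
  qed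
  define h where "h = b / m\<^sup>2"
  have h0: "h \<ge> 0" unfolding h_def by simp
  have shape: "shape p x = (m * x - g) / (m * x * g)" unfolding g_def by (rule shape_eq[OF x])
  have "m * x / g - 1 = m * x * shape p x"
    unfolding shape using g m_pos x by (simp add: field_simps)
  also have "\<dots> \<le> m * x * h"
    unfolding h_def using shape_le[OF x] m_pos x by (intro mult_left_mono) auto
  also have "\<dots> = x * (b / m)" unfolding h_def using m_pos by (simp add: field_simps power2_eq_square)
  also have "b / m \<le> (c + 1) * (1 + m)"
    using second_le_mean m_pos by (simp add: divide_le_eq mult_ac)
  finally have ratio: "m * x / g - 1 \<le> (c + 1) * ((1 + m) * x)" using x by (simp add: mult_ac)
  have "shape p x \<le> (b * x\<^sup>2 / 2) / (m * x * g)"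
    unfolding shape using lower g m_pos x by (intro divide_right_mono) auto
  also have "\<dots> = h / 2 * (m * x / g)"
    unfolding h_def using g m_pos x by (simp add: field_simps power2_eq_square)
  finally have "shape p x - h / 2 \<le> h / 2 * (m * x / g - 1)" by (simp add: algebra_simps)
  also have "\<dots> \<le> h / 2 * ((c + 1) * ((1 + m) * x))"
    using ratio h0 by (intro mult_left_mono) auto
  also have "\<dots> \<le> h * ((c + 1) * ((1 + m) * x))"
    using h0 c m_pos x by (intro mult_right_mono) auto
  finally have up: "shape p x - h / 2 \<le> (c + 1) * h * ((1 + m) * x)" by (simp add: mult_ac)
  have "h / 2 - h / 6 * (c * ((1 + m) * x)) = (b * x\<^sup>2 / 2 - c * b * (1 + m) * x ^ 3 / 6) / (m * x * (m * x))"
    unfolding h_def using m_pos x by (simp add: field_simps power2_eq_square power3_eq_cube)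
  also have "\<dots> \<le> (m * x - g) / (m * x * (m * x))"
  proof -
    have "fmoment3 p * x ^ 3 \<le> c * b * (1 + m) * x ^ 3"
      using third_le x by (intro mult_right_mono) auto
    then have "b * x\<^sup>2 / 2 - c * b * (1 + m) * x ^ 3 / 6 \<le> m * x - g" using upper by argo
    then show ?thesis using m_pos x by (intro divide_right_mono) auto
  qed
  also have "\<dots> \<le> shape p x"
    unfolding shape using g m_pos x by (intro divide_left_mono mult_left_mono mult_pos_pos) auto
  finally have "h / 2 - shape p x \<le> h / 6 * (c * ((1 + m) * x))" by simp
  also have "\<dots> \<le> h * ((c + 1) * ((1 + m) * x))"
    using h0 c m_pos x by (intro mult_mono) auto
  finally have "h / 2 - shape p x \<le> (c + 1) * h * ((1 + m) * x)" by (simp add: mult_ac)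
  with up show ?thesis unfolding h_def by linarith
qed

end

end

section \<open>Perturbed telescoping sums\<close>

text \<open>The increments of the decreasing sequence \<open>w\<close> are comparable with \<open>J\<close>, and each
differs from \<open>J k / 2\<close> by at most \<open>J k\<close>, and by little if \<open>w (Suc k)\<close> is
large compared with \<open>r k + r (Suc k)\<close>.  Telescoping gives \<open>w k \<ge> c * (S n - S k)\<close>,
so the second estimate is good as long as \<open>S k\<close> stays below a fixed fraction of
\<open>S n\<close>.  The remaining indices carry only a small part of the total mass \<open>S n\<close>,
because no single \<open>J k\<close> is large: it is bounded by a multiple of \<open>r k + r (Suc k)\<close>,
and \<open>r\<close> is \<open>o(S)\<close>.\<close>

lemma partial_sums_close:
  fixes J e r :: "nat \<Rightarrow> real" and c C \<epsilon> :: real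
  defines "S \<equiv> \<lambda>n. \<Sum>k<n. J k"
  assumes J0: "\<And>k. 0 \<le> J k" and Je: "\<And>k. J k \<le> C * (r k + r (Suc k))"
    and S: "filterlim S at_top sequentially"
    and r: "\<And>\<delta>. 0 < \<delta> \<Longrightarrow> \<forall>\<^sub>F n in sequentially. r n \<le> \<delta> * S n"
    and c: "0 < c" and C: "0 < C" and \<epsilon>: "0 < \<epsilon>"
  shows "\<forall>\<^sub>F n in sequentially. \<forall>w::nat \<Rightarrow> real. (\<forall>k\<le>n. 0 < w k) \<longrightarrow>
      (\<forall>k<n. c * J k \<le> w k - w (Suc k) \<and> w k - w (Suc k) \<le> J k \<and>
         \<bar>w k - w (Suc k) - J k / 2\<bar> * w (Suc k) \<le> C * J k * (r k + r (Suc k)))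
      \<longrightarrow> \<bar>w 0 - w n - S n / 2\<bar> \<le> \<epsilon> * S n"
proof -
  define \<delta> where "\<delta> = \<epsilon> / 4"
  have \<delta>: "\<delta> > 0" unfolding \<delta>_def using \<epsilon> by simp
  \<comment> \<open>The two terms of the minimum serve the size of a single step near the cutoff and the relative error before it.\<close>
  define \<eta> where "\<eta> = min (\<epsilon> / (4 * C)) (\<epsilon> * c * \<delta> / (4 * C))"
  have \<eta>: "\<eta> > 0" "C * \<eta> \<le> \<epsilon> / 4" "C * \<eta> \<le> \<epsilon> / 4 * (c * \<delta>)"
  proof -
    show "\<eta> > 0" unfolding \<eta>_def using \<epsilon> C c \<delta> by simp
    have "C * \<eta> \<le> C * (\<epsilon> / (4 * C))" unfolding \<eta>_def using C by (intro mult_left_mono) auto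
    then show "C * \<eta> \<le> \<epsilon> / 4" using C by simp
    have "C * \<eta> \<le> C * (\<epsilon> * c * \<delta> / (4 * C))" unfolding \<eta>_def using C by (intro mult_left_mono) auto
    then show "C * \<eta> \<le> \<epsilon> / 4 * (c * \<delta>)" using C by simp
  qed
  have S_Suc: "S (Suc k) = S k + J k" for k unfolding S_def by simp
  have S_mono: "S i \<le> S j" if "i \<le> j" for i j
    using that by (rule lift_Suc_mono_le[rotated]) (simp add: S_Suc J0)
  have S0: "S n \<ge> 0" for n using S_mono[of 0 n] by (simp add: S_def)
  obtain K where K: "\<And>n. n \<ge> K \<Longrightarrow> r n \<le> \<eta> / 2 * S n"
    using r[of "\<eta> / 2"] \<eta>(1) unfolding eventually_sequentially by auto
  have eK: "r k + r (Suc k) \<le> \<eta> * S (Suc k)" if "k \<ge> K" for k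
  proof -
    have "r k \<le> \<eta> / 2 * S (Suc k)"
    proof -
      have "\<eta> / 2 * S k \<le> \<eta> / 2 * S (Suc k)"
        using \<eta>(1) S_mono[of k "Suc k"] by (intro mult_left_mono) auto
      then show ?thesis using K[OF that] by linarith
    qed
    then show ?thesis using K[of "Suc k"] that by simp
  qed
  have "\<forall>\<^sub>F n in sequentially. 4 * S K / \<epsilon> \<le> S n"
    using S unfolding filterlim_at_top by blast
  then have "\<forall>\<^sub>F n in sequentially. K \<le> n \<and> 4 * S K / \<epsilon> \<le> S n"
    by (intro eventually_conj eventually_ge_at_top)
  then show ?thesis
  proof (rule eventually_mono, intro allI impI)
    fix n and w :: "nat \<Rightarrow> real" assume n: "K \<le> n \<and> 4 * S K / \<epsilon> \<le> S n"
    assume w0: "\<forall>k\<le>n. 0 < w k"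
    assume w: "\<forall>k<n. c * J k \<le> w k - w (Suc k) \<and> w k - w (Suc k) \<le> J k \<and>
         \<bar>w k - w (Suc k) - J k / 2\<bar> * w (Suc k) \<le> C * J k * (r k + r (Suc k))"
    have tele: "c * (S n - S k) \<le> w k" if "k \<le> n" for k
    proof -
      have "c * (S n - S k) \<le> w k - w n"
        using that
      proof (induction rule: inc_induct)
        case (step k)
        then have "c * J k \<le> w k - w (Suc k)" using w by simp
        then show ?case using step.IH by (simp add: S_Suc algebra_simps)
      qed simp
      then show ?thesis using w0[rule_format, of n] by simp
    qed
    define D where "D k = \<bar>w k - w (Suc k) - J k / 2\<bar>" for k
    have DJ: "D k \<le> J k" if "k < n" for k
    proof -
      have "c * J k \<le> w k - w (Suc k)" "w k - w (Suc k) \<le> J k" using w that by auto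
      moreover have "0 \<le> c * J k" using c J0 by simp
      ultimately show ?thesis unfolding D_def using J0[of k] by (simp add: abs_le_iff)
    qed
    \<comment> \<open>The mass of the terms with \<open>S k \<ge> \<theta>\<close> is the increase of \<open>max (S k) \<theta>\<close>, which telescopes.\<close>
    define \<theta> where "\<theta> = (1 - \<delta> - C * \<eta>) * S n"
    define T where "T k = max (S k) \<theta>" for k
    have T_mono: "T k \<le> T (Suc k)" for k
      unfolding T_def using S_mono[of k "Suc k"] by auto
    have Dk: "D k \<le> (if k < K then J k else 0) + \<epsilon> / 4 * J k + (T (Suc k) - T k)" if k: "k < n" for k
    proof -
      have eJ: "0 \<le> \<epsilon> / 4 * J k" using \<epsilon> J0 by simp
      consider "k < K" | "k \<ge> K" "S (Suc k) \<le> (1 - \<delta>) * S n" | "k \<ge> K" "S (Suc k) > (1 - \<delta>) * S n"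
        by linarith
      then show ?thesis
      proof cases
        case 1 then show ?thesis using DJ[OF k] eJ T_mono[of k] by simp
      next
        case 2
        show ?thesis
        proof (cases "S n = 0")
          case True
          then have "S k = 0" "S (Suc k) = 0"
            using S0[of k] S0[of "Suc k"] S_mono[of k n] S_mono[of "Suc k" n] k by auto
          then have "J k = 0" by (simp add: S_Suc)
          then show ?thesis using DJ[OF k] T_mono[of k] 2 by simp
        next
          case False
          then have Sn: "S n > 0" using S0[of n] by simp
          have "c * (\<delta> * S n) \<le> c * (S n - S (Suc k))"
            using 2 c by (intro mult_left_mono) (auto simp: algebra_simps)
          also have "\<dots> \<le> w (Suc k)" using tele[of "Suc k"] k by simp
          finally have "D k * (c * (\<delta> * S n)) \<le> D k * w (Suc k)"
            by (intro mult_left_mono) (auto simp: D_def)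
          also have "\<dots> \<le> C * J k * (r k + r (Suc k))" using w k unfolding D_def by simp
          also have "\<dots> \<le> C * J k * (\<eta> * S (Suc k))"
            using eK[of k] 2 C J0[of k] by (intro mult_left_mono) auto
          also have "\<dots> \<le> C * J k * (\<eta> * S n)"
            using S_mono[of "Suc k" n] k C J0[of k] \<eta>(1) by (intro mult_left_mono) auto
          also have "\<dots> = (C * \<eta>) * (J k * S n)" by simp
          also have "\<dots> \<le> (\<epsilon> / 4 * (c * \<delta>)) * (J k * S n)"
            using \<eta>(3) J0[of k] Sn by (intro mult_right_mono) auto
          finally have "D k * (c * \<delta> * S n) \<le> (\<epsilon> / 4 * J k) * (c * \<delta> * S n)" by (simp add: mult_ac)
          then have "D k \<le> \<epsilon> / 4 * J k"
            by (rule mult_right_le_imp_le) (use c \<delta> Sn in auto)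
          then show ?thesis using T_mono[of k] 2 by simp
        qed
      next
        case 3
        have "J k \<le> C * (r k + r (Suc k))" by (rule Je)
        also have "\<dots> \<le> C * (\<eta> * S (Suc k))" using eK[OF 3(1)] C by (intro mult_left_mono) auto
        also have "\<dots> \<le> C * \<eta> * S n"
          using S_mono[of "Suc k" n] k C \<eta>(1) by (simp add: mult_left_mono)
        finally have "\<theta> \<le> S k" using 3(2) unfolding \<theta>_def by (simp add: S_Suc algebra_simps)
        then have "T (Suc k) - T k = J k" unfolding T_def using S_mono[of k "Suc k"] by (simp add: S_Suc)
        then show ?thesis using DJ[OF k] eJ 3 by simp
      qed
    qed
    have "w 0 - w n - S n / 2 = (\<Sum>k<n. w k - w (Suc k) - J k / 2)"
      unfolding S_def sum_divide_distrib sum_subtractf[of "\<lambda>k. w k - w (Suc k)"] sum_lessThan_telescope' ..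
    also have "\<bar>\<dots>\<bar> \<le> (\<Sum>k<n. D k)" unfolding D_def by (rule sum_abs)
    also have "\<dots> \<le> (\<Sum>k<n. (if k < K then J k else 0) + \<epsilon> / 4 * J k + (T (Suc k) - T k))"
      by (intro sum_mono Dk) simp
    also have "\<dots> = (\<Sum>k<n. if k < K then J k else 0) + \<epsilon> / 4 * S n + (T n - T 0)"
      by (simp add: sum.distrib sum_distrib_left S_def sum_lessThan_telescope del: sum_subtractf)
    also have "(\<Sum>k<n. if k < K then J k else 0) = S K"
      unfolding S_def using n by (simp add: sum.If_cases Int_def cong: conj_cong) (rule sum.cong, auto)
    also have "S K \<le> \<epsilon> / 4 * S n" using n \<epsilon> by (simp add: field_simps)
    also have "T n - T 0 \<le> \<epsilon> / 2 * S n"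
    proof -
      have "T n = S n"
      proof -
        have "0 \<le> (\<delta> + C * \<eta>) * S n" using \<delta> \<eta>(1) C S0[of n] by simp
        then have "\<theta> \<le> S n" unfolding \<theta>_def by (simp add: algebra_simps)
        then show ?thesis unfolding T_def by simp
      qed
      moreover have "\<theta> \<le> T 0" unfolding T_def by simp
      ultimately have "T n - T 0 \<le> S n - \<theta>" by simp
      also have "\<dots> = (\<delta> + C * \<eta>) * S n" unfolding \<theta>_def by (simp add: algebra_simps)
      also have "\<dots> \<le> (\<epsilon> / 2) * S n"
        using \<eta>(2) S0[of n] unfolding \<delta>_def by (intro mult_right_mono) auto
      finally show ?thesis .
    qed
    finally show "\<bar>w 0 - w n - S n / 2\<bar> \<le> \<epsilon> * S n" by simp
  qed
qed

section \<open>Survival probabilities in a critical environment\<close>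

text \<open>The probability that generation \<open>n\<close> contains a marked individual, if its members are marked
independently with probability \<open>x\<close>; at \<open>x = 1\<close> it is the survival probability.\<close>

primrec thin :: "(nat \<Rightarrow> nat pmf) \<Rightarrow> nat \<Rightarrow> real \<Rightarrow> real" where
  "thin q 0 x = x"
| "thin q (Suc n) x = thin q n (alive (q (Suc n)) x)"

text \<open>The value \<open>y k\<close> is the probability of a marked descendant in generation \<open>n\<close> for an
individual of generation \<open>k\<close>.\<close>

lemma thin_backward_orbit:
  "\<exists>y. y n = x \<and> (\<forall>k<n. y k = alive (q (Suc k)) (y (Suc k))) \<and> y 0 = thin q n x"
proof (induction n arbitrary: x)
  case 0
  show ?case by (intro exI[of _ "\<lambda>_. x"]) simp
next
  case (Suc n)
  obtain y where y: "y n = alive (q (Suc n)) x" "\<forall>k<n. y k = alive (q (Suc k)) (y (Suc k))"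
    "y 0 = thin q n (alive (q (Suc n)) x)"
    using Suc by blast
  show ?case
    by (intro exI[of _ "y(Suc n := x)"]) (use y in \<open>auto simp: less_Suc_eq\<close>)
qed

lemma env_mu_Suc: "env_mu q (Suc n) = env_mu q n * mean (q (Suc n))"
  unfolding env_mu_def mean_def by simp

lemma env_nu_eq: "env_nu q n = fmoment2 (q n) / (mean (q n))\<^sup>2"
  unfolding env_nu_def mean_def fmoment2_def by simp

locale critical_third_moment =
  fixes q :: "nat \<Rightarrow> nat pmf"
  assumes critical: "critical_env q"
    and third_moment: "\<exists>c>0. \<forall>n\<ge>1.
           gf_deriv1 3 (q n) \<le> ennreal c * gf_deriv1 2 (q n) * (1 + gf_deriv1 1 (q n))"
begin

lemma offspring_law: "n \<ge> 1 \<Longrightarrow> offspring_law (q n)"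
  using critical unfolding critical_env_def regular_env_def varying_env_def offspring_law_def by blast

abbreviation J :: "nat \<Rightarrow> real" where "J k \<equiv> env_nu q (Suc k) / env_mu q k"
abbreviation S :: "nat \<Rightarrow> real" where "S n \<equiv> (\<Sum>k<n. J k)"

lemma mu_pos: "0 < env_mu q n"
proof (induction n)
  case (Suc n)
  then show ?case using offspring_law.m_pos[OF offspring_law[of "Suc n"]] by (simp add: env_mu_Suc)
qed (simp add: env_mu_def)

lemma J_nonneg: "0 \<le> J k"
  using mu_pos[of k] by (simp add: env_nu_eq fmoment2_def)

lemma S_at_top: "filterlim S at_top sequentially"
  using critical unfolding critical_env_def by blast

lemma mu_S_at_top: "filterlim (\<lambda>n. env_mu q n * S n) at_top sequentially"
  using critical unfolding critical_env_def by blast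

lemma inverse_mu_small:
  assumes "0 < \<delta>"
  shows "\<forall>\<^sub>F n in sequentially. 1 / env_mu q n \<le> \<delta> * S n"
proof -
  have "\<forall>\<^sub>F n in sequentially. 1 / \<delta> \<le> env_mu q n * S n"
    using mu_S_at_top unfolding filterlim_at_top by blast
  then show ?thesis
    by eventually_elim (use assms mu_pos in \<open>simp add: field_simps\<close>)
qed

lemma thin_bounds:
  assumes "0 < x" "x \<le> 1"
  shows "0 < thin q n x" "thin q n x \<le> 1"
proof -
  have "0 < thin q n x \<and> thin q n x \<le> 1"
    using assms
  proof (induction n arbitrary: x)
    case (Suc n)
    interpret offspring_law "q (Suc n)" by (rule offspring_law) simp
    show ?case using Suc.IH[of "alive (q (Suc n)) x"] alive_pos[OF Suc.prems] alive_bounds(2)[of x "q (Suc n)"] Suc.prems by simp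
  qed simp
  then show "0 < thin q n x" "thin q n x \<le> 1" by auto
qed

text \<open>With \<open>w k = 1 / (\<mu> k * y k)\<close> along the backward orbit of \<open>x\<close>, the recursion
\<open>y k = alive (q (Suc k)) (y (Suc k))\<close> becomes additive: each step of \<open>w\<close> is a value of
\<open>shape\<close> divided by \<open>\<mu> k\<close>.  The bounds on \<open>shape\<close> are the hypotheses of
\<open>partial_sums_close\<close> for \<open>r k = 1 / \<mu> k\<close>, and its conclusion is uniform in
\<open>w\<close>, hence in \<open>x\<close>, which may therefore depend on \<open>n\<close>.\<close>

lemma thin_asymptotics:
  assumes \<epsilon>: "0 < \<epsilon>"
  shows "\<forall>\<^sub>F n in sequentially. \<forall>x. 0 < x \<and> x \<le> 1 \<longrightarrow>
           \<bar>1 / thin q n x - 1 / (env_mu q n * x) - S n / 2\<bar> \<le> \<epsilon> * S n"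
proof -
  obtain c where c: "c > 0" and reg: "\<And>n. n \<ge> 1 \<Longrightarrow>
      measure_pmf.expectation (q n) (\<lambda>k. (real k)\<^sup>2 * indicator {2..} k)
        \<le> c * measure_pmf.expectation (q n) (\<lambda>k. real k * indicator {2..} k)
            * measure_pmf.expectation (cond_pmf (q n) {1..}) real"
    using critical unfolding critical_env_def regular_env_def by blast
  obtain d where d: "d > 0" and third: "\<And>n. n \<ge> 1 \<Longrightarrow>
      gf_deriv1 3 (q n) \<le> ennreal d * gf_deriv1 2 (q n) * (1 + gf_deriv1 1 (q n))"
    using third_moment by blast
  have r_sum: "(1 + mean (q (Suc k))) / env_mu q (Suc k) = 1 / env_mu q k + 1 / env_mu q (Suc k)" for k
  proof -
    have "mean (q (Suc k)) > 0" by (rule offspring_law.m_pos[OF offspring_law]) simp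
    then show ?thesis using mu_pos[of k] by (simp add: env_mu_Suc field_simps)
  qed
  have "\<forall>\<^sub>F n in sequentially. \<forall>w::nat \<Rightarrow> real. (\<forall>k\<le>n. 0 < w k) \<longrightarrow>
      (\<forall>k<n. 1 / (4 * c) * J k \<le> w k - w (Suc k) \<and> w k - w (Suc k) \<le> J k \<and>
         \<bar>w k - w (Suc k) - J k / 2\<bar> * w (Suc k) \<le> (d + 1) * J k * (1 / env_mu q k + 1 / env_mu q (Suc k)))
      \<longrightarrow> \<bar>w 0 - w n - S n / 2\<bar> \<le> \<epsilon> * S n"
  proof (rule partial_sums_close)
    fix k
    interpret offspring_law "q (Suc k)" by (rule offspring_law) simp
    have "J k * env_mu q (Suc k) = b / m"
      unfolding env_nu_eq env_mu_Suc using mu_pos[of k] m_pos by (simp add: field_simps power2_eq_square)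
    also have "\<dots> \<le> (d + 1) * (1 + m)"
      using second_le_mean[OF d third[of "Suc k"]] m_pos by (simp add: divide_le_eq mult_ac)
    finally have "J k \<le> (d + 1) * ((1 + m) / env_mu q (Suc k))"
      using mu_pos[of "Suc k"] by (simp add: field_simps)
    then show "J k \<le> (d + 1) * (1 / env_mu q k + 1 / env_mu q (Suc k))"
      unfolding r_sum .
  qed (use S_at_top inverse_mu_small J_nonneg c d \<epsilon> in auto)
  then show ?thesis
  proof eventually_elim
    case (elim n)
    show ?case
    proof (intro allI impI)
      fix x :: real assume x: "0 < x \<and> x \<le> 1"
      obtain y where y: "y n = x" "\<And>k. k < n \<Longrightarrow> y k = alive (q (Suc k)) (y (Suc k))" "y 0 = thin q n x"
        using thin_backward_orbit[of n x q] by blast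
      have y_bounds: "0 < y k \<and> y k \<le> 1" if "k \<le> n" for k
        using that
      proof (induction rule: inc_induct)
        case base then show ?case using x y(1) by simp
      next
        case (step k)
        interpret offspring_law "q (Suc k)" by (rule offspring_law) simp
        show ?case using step y(2) alive_pos alive_bounds(2) by simp
      qed
      define w where "w k = 1 / (env_mu q k * y k)" for k
      have "\<bar>w 0 - w n - S n / 2\<bar> \<le> \<epsilon> * S n"
      proof (rule elim[rule_format])
        fix k assume "k \<le> n"
        then show "0 < w k" unfolding w_def using y_bounds mu_pos by simp
      next
        fix k assume k: "k < n"
        interpret offspring_law "q (Suc k)" by (rule offspring_law) simp
        have z: "0 < y (Suc k)" "y (Suc k) \<le> 1" using y_bounds[of "Suc k"] k by auto
        have mu: "0 < env_mu q k" "0 < env_mu q (Suc k)" by (rule mu_pos)+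
        have diff: "w k - w (Suc k) = shape (q (Suc k)) (y (Suc k)) / env_mu q k"
          unfolding w_def shape_def y(2)[OF k] env_mu_Suc by (simp add: diff_divide_distrib mult_ac)
        have J_eq: "J k = b / m\<^sup>2 / env_mu q k" by (simp add: env_nu_eq)
        have "b / (4 * c * m\<^sup>2) / env_mu q k \<le> w k - w (Suc k)"
          unfolding diff using shape_ge_regular[OF z c reg] mu by (intro divide_right_mono) auto
        moreover have "w k - w (Suc k) \<le> J k"
          unfolding diff J_eq using shape_le[OF z] mu by (intro divide_right_mono) auto
        moreover have "\<bar>w k - w (Suc k) - J k / 2\<bar> * w (Suc k)
            \<le> (d + 1) * J k * (1 / env_mu q k + 1 / env_mu q (Suc k))"
        proof -
          have "w k - w (Suc k) - J k / 2 = (shape (q (Suc k)) (y (Suc k)) - b / m\<^sup>2 / 2) / env_mu q k"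
            unfolding diff J_eq by (simp add: diff_divide_distrib)
          then have "\<bar>w k - w (Suc k) - J k / 2\<bar> * w (Suc k)
              = \<bar>shape (q (Suc k)) (y (Suc k)) - b / m\<^sup>2 / 2\<bar> / env_mu q k * w (Suc k)"
            using mu by (simp add: abs_divide)
          also have "\<dots> \<le> ((d + 1) * (b / m\<^sup>2) * ((1 + m) * y (Suc k))) / env_mu q k * w (Suc k)"
            using shape_near[OF d third z] mu z
            by (intro mult_right_mono divide_right_mono) (auto simp: w_def)
          also have "\<dots> = (d + 1) * J k * ((1 + m) / env_mu q (Suc k))"
            unfolding J_eq w_def using z mu by simp
          finally show ?thesis unfolding r_sum .
        qed
        ultimately show "1 / (4 * c) * J k \<le> w k - w (Suc k) \<and> w k - w (Suc k) \<le> J k \<and>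
            \<bar>w k - w (Suc k) - J k / 2\<bar> * w (Suc k) \<le> (d + 1) * J k * (1 / env_mu q k + 1 / env_mu q (Suc k))"
          by (simp add: J_eq mult_ac)
      qed
      then show "\<bar>1 / thin q n x - 1 / (env_mu q n * x) - S n / 2\<bar> \<le> \<epsilon> * S n"
        unfolding w_def y by (simp add: env_mu_def y)
    qed
  qed
qed

text \<open>The reciprocal of \<open>thin\<close> divided by \<open>S n\<close>: the limit splits into a part \<open>L\<close>
due to the marking probability and a part \<open>1 / 2\<close> due to the environment.\<close>

lemma thin_scaled_limit:
  assumes x: "\<forall>\<^sub>F n in sequentially. 0 < x n \<and> x n \<le> 1"
    and lim: "(\<lambda>n. 1 / (env_mu q n * S n * x n)) \<longlonglongrightarrow> L"
  shows "(\<lambda>n. 1 / (S n * thin q n (x n))) \<longlonglongrightarrow> L + 1 / 2"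
proof -
  have Spos: "\<forall>\<^sub>F n in sequentially. 0 < S n"
    using S_at_top unfolding filterlim_at_top_dense by blast
  have "(\<lambda>n. 1 / (S n * thin q n (x n)) - 1 / (env_mu q n * S n * x n)) \<longlonglongrightarrow> 1 / 2"
  proof (rule tendstoI)
    fix e :: real assume e: "0 < e"
    then have "0 < e / 2" by simp
    from thin_asymptotics[OF this] x Spos
    show "\<forall>\<^sub>F n in sequentially.
        dist (1 / (S n * thin q n (x n)) - 1 / (env_mu q n * S n * x n)) (1 / 2) < e"
    proof eventually_elim
      case (elim n)
      let ?D = "1 / thin q n (x n) - 1 / (env_mu q n * x n) - S n / 2"
      have "1 / (S n * thin q n (x n)) - 1 / (env_mu q n * S n * x n) - 1 / 2 = ?D / S n"
        using elim by (simp add: diff_divide_distrib mult_ac)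
      then have "dist (1 / (S n * thin q n (x n)) - 1 / (env_mu q n * S n * x n)) (1 / 2) = \<bar>?D\<bar> / S n"
        using elim by (simp add: dist_real_def abs_divide)
      also have "\<dots> \<le> e / 2" using elim by (simp add: divide_le_eq)
      finally show ?case using e by simp
    qed
  qed
  from tendsto_add[OF this lim] show ?thesis by (simp add: add.commute)
qed

lemma env_a_at_top: "filterlim (env_a q) at_top sequentially"
proof -
  have "filterlim (\<lambda>n. 1 / 2 * (env_mu q n * S n)) at_top sequentially"
    by (rule filterlim_tendsto_pos_mult_at_top[OF tendsto_const _ mu_S_at_top]) simp
  moreover have "\<forall>\<^sub>F n in sequentially. 1 / 2 * (env_mu q n * S n) = env_a q n"
    using eventually_gt_at_top[of 0] by eventually_elim (simp add: env_a_def)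
  ultimately show ?thesis by (simp add: filterlim_cong)
qed

text \<open>In \<open>thin_scaled_limit\<close> the marking probability \<open>1 - exp (- j / a)\<close> contributes \<open>1 / (2 * j)\<close> as
\<open>L\<close>, and the marking probability \<open>1\<close> contributes \<open>0\<close>.\<close>

lemma thin_ratio_limit:
  assumes j: "j > 0"
  shows "(\<lambda>n. thin q n (1 - exp (- real j / env_a q n)) / thin q n 1) \<longlonglongrightarrow> real j / (1 + real j)"
proof -
  let ?x = "\<lambda>n. 1 - exp (- real j / env_a q n)"
  have a_pos: "\<forall>\<^sub>F n in sequentially. 0 < env_a q n"
    using env_a_at_top unfolding filterlim_at_top_dense by blast
  have a_eq: "\<forall>\<^sub>F n in sequentially. env_mu q n * S n = 2 * env_a q n"
    using eventually_gt_at_top[of 0] by eventually_elim (simp add: env_a_def)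
  have x: "\<forall>\<^sub>F n in sequentially. 0 < ?x n \<and> ?x n \<le> 1"
    using a_pos by eventually_elim (use j in auto)
  have "(\<lambda>n. 1 / (env_mu q n * S n * 1)) \<longlonglongrightarrow> 0"
    using tendsto_divide_0[OF tendsto_const filterlim_at_top_imp_at_infinity[OF mu_S_at_top]] by simp
  from thin_scaled_limit[OF _ this]
  have one: "(\<lambda>n. 1 / (S n * thin q n 1)) \<longlonglongrightarrow> 1 / 2" by simp
  have "((\<lambda>t::real. 1 / (2 * t * (1 - exp (- real j / t)))) \<longlongrightarrow> 1 / (2 * real j)) at_top"
    using j by (real_asymp simp: field_simps)
  from filterlim_compose[OF this env_a_at_top]
  have "(\<lambda>n. 1 / (2 * env_a q n * ?x n)) \<longlonglongrightarrow> 1 / (2 * real j)" .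
  moreover have "\<forall>\<^sub>F n in sequentially. 1 / (2 * env_a q n * ?x n) = 1 / (env_mu q n * S n * ?x n)"
    using a_eq by eventually_elim simp
  ultimately have "(\<lambda>n. 1 / (env_mu q n * S n * ?x n)) \<longlonglongrightarrow> 1 / (2 * real j)"
    by (rule Lim_transform_eventually)
  from thin_scaled_limit[OF x this]
  have "(\<lambda>n. 1 / (S n * thin q n (?x n))) \<longlonglongrightarrow> 1 / (2 * real j) + 1 / 2" .
  moreover have "1 / (2 * real j) + 1 / 2 \<noteq> 0" using j by (simp add: add_nonneg_eq_0_iff)
  ultimately have ratio: "(\<lambda>n. (1 / (S n * thin q n 1)) / (1 / (S n * thin q n (?x n))))
      \<longlonglongrightarrow> (1 / 2) / (1 / (2 * real j) + 1 / 2)"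
    by (intro tendsto_divide one)
  have limit_eq: "(1 / 2) / (1 / (2 * real j) + 1 / 2) = real j / (1 + real j)"
    using j by (simp add: field_simps)
  have "\<forall>\<^sub>F n in sequentially. 0 < S n"
    using S_at_top unfolding filterlim_at_top_dense by blast
  then have "\<forall>\<^sub>F n in sequentially.
      (1 / (S n * thin q n 1)) / (1 / (S n * thin q n (?x n))) = thin q n (?x n) / thin q n 1"
    by eventually_elim simp
  from Lim_transform_eventually[OF ratio this] show ?thesis unfolding limit_eq .
qed

end

section \<open>Generating functions of the process\<close>

lemma measurable_gw:
  assumes "\<And>j i. 1 \<le> j \<Longrightarrow> j \<le> n \<Longrightarrow> 1 \<le> i \<Longrightarrow> chi j i \<in> measurable L (count_space UNIV)"
  shows "gw chi n \<in> measurable L (count_space UNIV)"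
  using assms
proof (induction n)
  case (Suc n)
  have add: "(\<lambda>x. f x + g x) \<in> measurable L (count_space UNIV)"
    if "f \<in> measurable L (count_space UNIV)" "g \<in> measurable L (count_space UNIV)"
    for f g :: "'a \<Rightarrow> nat"
    by (rule measurable_compose_countable[OF _ that(1)], rule measurable_compose[OF that(2)]) simp
  have "(\<lambda>\<omega>. \<Sum>i=1..k. chi (Suc n) i \<omega>) \<in> measurable L (count_space UNIV)" for k
    by (induction k) (auto intro!: add Suc.prems)
  moreover have "gw chi n \<in> measurable L (count_space UNIV)"
    by (rule Suc.IH) (simp add: Suc.prems)
  ultimately show ?case
    unfolding gw.simps by (rule measurable_compose_countable)
next
  case 0
  have "gw chi 0 = (\<lambda>_. 1)" by auto
  then show ?case by simp
qed

text \<open>Only generations up to \<open>n\<close> matter, which allows \<open>gw chi n\<close> to be read as a function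
on a product space indexed by these generations.\<close>

lemma gw_cong:
  assumes "\<And>j i. 1 \<le> j \<Longrightarrow> j \<le> n \<Longrightarrow> 1 \<le> i \<Longrightarrow> chi j i \<omega> = chi' j i \<omega>'"
  shows "gw chi n \<omega> = gw chi' n \<omega>'"
  using assms
proof (induction n)
  case (Suc n)
  have "gw chi n \<omega> = gw chi' n \<omega>'" by (rule Suc.IH) (simp add: Suc.prems)
  then show ?case using Suc.prems by (auto intro!: sum.cong)
qed simp

text \<open>Conditioning on the value of \<open>Z\<close>, in the form in which the recursion for the generating
function is obtained from its restriction to each generation size.\<close>

lemma (in prob_space) expectation_eq_on_fibres:
  fixes Z :: "'a \<Rightarrow> nat" and U V :: "'a \<Rightarrow> real"
  assumes Z: "Z \<in> measurable M (count_space UNIV)"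
    and UV: "U \<in> borel_measurable M" "V \<in> borel_measurable M"
      "\<And>\<omega>. 0 \<le> U \<omega>" "\<And>\<omega>. U \<omega> \<le> 1" "\<And>\<omega>. 0 \<le> V \<omega>" "\<And>\<omega>. V \<omega> \<le> 1"
    and eq: "\<And>k. expectation (\<lambda>\<omega>. indicator {k} (Z \<omega>) * U \<omega>) = expectation (\<lambda>\<omega>. indicator {k} (Z \<omega>) * V \<omega>)"
  shows "expectation U = expectation V"
proof -
  have ind: "(\<lambda>\<omega>. indicator {k} (Z \<omega>) :: real) \<in> borel_measurable M" for k
    by (rule measurable_compose[OF Z]) simp
  have *: "expectation W = enn2real (\<Sum>k. ennreal (expectation (\<lambda>\<omega>. indicator {k} (Z \<omega>) * W \<omega>)))"
    if Wm: "W \<in> borel_measurable M" and W: "\<And>\<omega>. 0 \<le> W \<omega>" "\<And>\<omega>. W \<omega> \<le> 1" for W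
  proof -
    have meas: "(\<lambda>\<omega>. indicator {k} (Z \<omega>) * W \<omega>) \<in> borel_measurable M" for k
      by (intro borel_measurable_times ind Wm)
    have "expectation W = enn2real (\<integral>\<^sup>+\<omega>. ennreal (W \<omega>) \<partial>M)"
      using W Wm by (subst integral_eq_nn_integral) auto
    also have "(\<integral>\<^sup>+\<omega>. ennreal (W \<omega>) \<partial>M) = (\<integral>\<^sup>+\<omega>. (\<Sum>k. ennreal (indicator {k} (Z \<omega>) * W \<omega>)) \<partial>M)"
    proof (intro nn_integral_cong)
      fix \<omega>
      have "(\<Sum>k. ennreal (indicator {k} (Z \<omega>) * W \<omega>)) = (\<Sum>k\<in>{Z \<omega>}. ennreal (indicator {k} (Z \<omega>) * W \<omega>))"
        by (rule suminf_finite) auto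
      then show "ennreal (W \<omega>) = (\<Sum>k. ennreal (indicator {k} (Z \<omega>) * W \<omega>))" by simp
    qed
    also have "\<dots> = (\<Sum>k. \<integral>\<^sup>+\<omega>. ennreal (indicator {k} (Z \<omega>) * W \<omega>) \<partial>M)"
      by (rule nn_integral_suminf) (rule measurable_compose[OF meas measurable_ennreal])
    also have "\<dots> = (\<Sum>k. ennreal (expectation (\<lambda>\<omega>. indicator {k} (Z \<omega>) * W \<omega>)))"
    proof (intro suminf_cong nn_integral_eq_integral)
      fix k
      show "integrable M (\<lambda>\<omega>. indicator {k} (Z \<omega>) * W \<omega>)"
        by (rule integrable_const_bound[where B = 1, OF _ meas]) (use W in \<open>auto simp: indicator_def\<close>)
    qed (use W in auto)
    finally show ?thesis .
  qed
  show ?thesis unfolding *[OF UV(1,3,4)] *[OF UV(2,5,6)] eq ..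
qed

locale varying_offspring = prob_space M for M :: "'a measure" +
  fixes q :: "nat \<Rightarrow> nat pmf" and chi :: "nat \<Rightarrow> nat \<Rightarrow> 'a \<Rightarrow> nat"
  assumes offspring: "offspring_family M q chi"
begin

lemma indep: "indep_vars (\<lambda>_. count_space UNIV) (\<lambda>(n, i). chi n i) ({1..} \<times> {1..})"
  using offspring unfolding offspring_family_def by blast

lemma chi_measurable [measurable]: "1 \<le> n \<Longrightarrow> 1 \<le> i \<Longrightarrow> chi n i \<in> measurable M (count_space UNIV)"
  using indep unfolding indep_vars_def by auto

lemma gw_measurable [measurable]: "gw chi n \<in> measurable M (count_space UNIV)"
  by (rule measurable_gw) (rule chi_measurable)

lemma distr_chi:
  assumes "1 \<le> n" "1 \<le> i"
  shows "distr M (count_space UNIV) (chi n i) = measure_pmf (q n)"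
proof (rule measure_eqI_countable[where A = UNIV])
  fix k
  have "emeasure (distr M (count_space UNIV) (chi n i)) {k} = emeasure M (chi n i -` {k} \<inter> space M)"
    using assms by (subst emeasure_distr) auto
  also have "chi n i -` {k} \<inter> space M = {\<omega> \<in> space M. chi n i \<omega> = k}" by auto
  also have "emeasure M \<dots> = ennreal (pmf (q n) k)"
    using offspring assms unfolding offspring_family_def by (simp add: emeasure_eq_measure)
  finally show "emeasure (distr M (count_space UNIV) (chi n i)) {k} = emeasure (measure_pmf (q n)) {k}"
    by (simp add: emeasure_pmf_single)
qed auto

lemma expectation_offspring_power:
  assumes "1 \<le> n" "1 \<le> i" "0 \<le> s" "s \<le> 1"
  shows "expectation (\<lambda>\<omega>. s ^ chi n i \<omega>) = 1 - alive (q n) (1 - s)"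
proof -
  have "expectation (\<lambda>\<omega>. s ^ chi n i \<omega>) = integral\<^sup>L (distr M (count_space UNIV) (chi n i)) (\<lambda>k. s ^ k)"
    using assms by (subst integral_distr) auto
  then show ?thesis using assms by (simp only: distr_chi expectation_power)
qed

text \<open>On the event that generation \<open>n\<close> has \<open>k\<close> members, the power of the next generation
is a product of \<open>k\<close> powers.  Grouping the family \<open>chi\<close> into the block of all
generations up to \<open>n\<close> and the single variables of the next one makes the indicator and these
factors independent.\<close>

lemma expectation_generation_step:
  assumes s: "0 \<le> s" "s \<le> 1"
  shows "expectation (\<lambda>\<omega>. indicator {k} (gw chi n \<omega>) * s ^ gw chi (Suc n) \<omega>)
       = expectation (\<lambda>\<omega>. indicator {k} (gw chi n \<omega>) * (1 - alive (q (Suc n)) (1 - s)) ^ gw chi n \<omega>)"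
proof -
  define K where "K j = (if j = 0 then {1..n} \<times> {1..} else {(Suc n, j)})" for j :: nat
  define Y :: "nat \<Rightarrow> (nat \<times> nat \<Rightarrow> nat) \<Rightarrow> real" where
    "Y j f = (if j = 0 then indicator {k} (gw (\<lambda>j i f. f (j, i)) n f) else s ^ f (Suc n, j))" for j f
  define X where "X j \<omega> = (if j = 0 then indicator {k} (gw chi n \<omega>) else s ^ chi (Suc n) j \<omega>)"
    for j and \<omega> :: 'a
  let ?R = "\<lambda>j \<omega>. restrict (\<lambda>ni. (case ni of (n, i) \<Rightarrow> chi n i) \<omega>) (K j)"
  have "indep_vars (\<lambda>j. PiM (K j) (\<lambda>_. count_space UNIV)) ?R {0..k}"
    by (rule indep_vars_restrict[OF indep]) (auto simp: K_def disjoint_family_on_def)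
  then have "indep_vars (\<lambda>_. borel) (\<lambda>j \<omega>. Y j (?R j \<omega>)) {0..k}"
  proof (rule indep_vars_compose2)
    fix j assume "j \<in> {0..k}"
    have comp: "(\<lambda>f. f ni) \<in> measurable (PiM (K j) (\<lambda>_. count_space (UNIV :: nat set))) (count_space UNIV)"
      if "ni \<in> K j" for ni
      using that by (rule measurable_component_singleton)
    show "Y j \<in> borel_measurable (PiM (K j) (\<lambda>_. count_space UNIV))"
    proof (cases "j = 0")
      case True
      have "gw (\<lambda>j i f. f (j, i)) n \<in> measurable (PiM (K j) (\<lambda>_. count_space (UNIV :: nat set))) (count_space UNIV)"
        by (rule measurable_gw) (rule comp, use True in \<open>simp add: K_def\<close>)
      from measurable_compose[OF this, of "indicator {k}" borel] show ?thesis
        unfolding Y_def using True by simp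
    next
      case False
      from measurable_compose[OF comp[of "(Suc n, j)"], of "\<lambda>i. s ^ i" borel] show ?thesis
        unfolding Y_def using False by (simp add: K_def)
    qed
  qed
  moreover have "Y j (?R j \<omega>) = X j \<omega>" for j \<omega>
  proof (cases "j = 0")
    case True
    have "gw (\<lambda>j i f. f (j, i)) n (?R j \<omega>) = gw chi n \<omega>"
      by (rule gw_cong) (use True in \<open>auto simp: K_def\<close>)
    then show ?thesis using True unfolding X_def Y_def by simp
  qed (simp add: X_def Y_def K_def)
  ultimately have ind: "indep_vars (\<lambda>_. borel) X {0..k}" by (simp add: fun_eq_iff)
  have X_int: "integrable M (X j)" if "j \<in> {0..k}" for j
  proof (rule integrable_const_bound[where B = 1])
    show "X j \<in> borel_measurable M" using ind that unfolding indep_vars_def by auto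
    show "AE \<omega> in M. norm (X j \<omega>) \<le> 1" unfolding X_def using s by (auto simp: indicator_def intro: power_le_one)
  qed
  have X_0: "expectation (X 0) = expectation (\<lambda>\<omega>. indicator {k} (gw chi n \<omega>))"
    by (rule Bochner_Integration.integral_cong) (simp_all add: X_def)
  have X_pos: "expectation (X j) = 1 - alive (q (Suc n)) (1 - s)" if "j \<in> {1..k}" for j
  proof -
    have "expectation (X j) = expectation (\<lambda>\<omega>. s ^ chi (Suc n) j \<omega>)"
      using that by (intro Bochner_Integration.integral_cong) (simp_all add: X_def)
    then show ?thesis using that s by (simp add: expectation_offspring_power)
  qed
  have split: "(\<Prod>j\<in>{0..k}. F j) = F 0 * (\<Prod>j=1..k. F j)" for F :: "nat \<Rightarrow> real"
    by (simp add: prod.atLeast_Suc_atMost)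
  have "(\<lambda>\<omega>. indicator {k} (gw chi n \<omega>) * s ^ gw chi (Suc n) \<omega>) = (\<lambda>\<omega>. \<Prod>j\<in>{0..k}. X j \<omega>)"
    unfolding split by (auto simp: X_def fun_eq_iff indicator_def power_sum)
  then have "expectation (\<lambda>\<omega>. indicator {k} (gw chi n \<omega>) * s ^ gw chi (Suc n) \<omega>)
      = (\<Prod>j\<in>{0..k}. expectation (X j))"
    using indep_vars_lebesgue_integral[OF _ ind X_int] by simp
  also have "\<dots> = expectation (\<lambda>\<omega>. indicator {k} (gw chi n \<omega>)) * (\<Prod>j=1..k. 1 - alive (q (Suc n)) (1 - s))"
    unfolding split X_0 using X_pos by simp
  also have "\<dots> = expectation (\<lambda>\<omega>. indicator {k} (gw chi n \<omega>) * (1 - alive (q (Suc n)) (1 - s)) ^ k)"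
    by simp
  also have "\<dots> = expectation (\<lambda>\<omega>. indicator {k} (gw chi n \<omega>) * (1 - alive (q (Suc n)) (1 - s)) ^ gw chi n \<omega>)"
    by (intro Bochner_Integration.integral_cong) (auto simp: indicator_def)
  finally show ?thesis .
qed

lemma expectation_gw_power:
  assumes "0 \<le> x" "x \<le> 1"
  shows "expectation (\<lambda>\<omega>. (1 - x) ^ gw chi n \<omega>) = 1 - thin q n x"
  using assms
proof (induction n arbitrary: x)
  case (Suc n)
  let ?x = "alive (q (Suc n)) x"
  have x: "0 \<le> ?x" "?x \<le> 1" using alive_bounds[OF Suc.prems] by auto
  have "expectation (\<lambda>\<omega>. (1 - x) ^ gw chi (Suc n) \<omega>) = expectation (\<lambda>\<omega>. (1 - ?x) ^ gw chi n \<omega>)"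
  proof (rule expectation_eq_on_fibres[OF gw_measurable[of n]])
    show "expectation (\<lambda>\<omega>. indicator {k} (gw chi n \<omega>) * (1 - x) ^ gw chi (Suc n) \<omega>)
       = expectation (\<lambda>\<omega>. indicator {k} (gw chi n \<omega>) * (1 - ?x) ^ gw chi n \<omega>)" for k
      using expectation_generation_step[of "1 - x" k n] Suc.prems by (simp del: gw.simps)
    show "(\<lambda>\<omega>. y ^ gw chi k \<omega>) \<in> borel_measurable M" for y :: real and k
      by (rule measurable_compose[OF gw_measurable]) simp
    then show "(\<lambda>\<omega>. (1 - ?x) ^ gw chi n \<omega>) \<in> borel_measurable M" .
  qed (use x Suc.prems in \<open>simp_all add: power_le_one del: gw.simps\<close>)
  also have "\<dots> = 1 - thin q n ?x" by (rule Suc.IH[OF x])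
  finally show ?case unfolding thin.simps .
qed (simp add: prob_space)

end

context varying_offspring
begin

abbreviation alive_event :: "nat \<Rightarrow> 'a set" where
  "alive_event n \<equiv> {\<omega> \<in> space M. gw chi n \<omega> > 0}"

lemma alive_event_measurable: "alive_event n \<in> events"
proof -
  have "alive_event n = gw chi n -` {0<..} \<inter> space M" by auto
  then show ?thesis using measurable_sets[OF gw_measurable, of "{0<..}" n] by simp
qed

lemma integrable_gw_power:
  fixes s :: real
  assumes "0 \<le> s" "s \<le> 1"
  shows "integrable M (\<lambda>\<omega>. s ^ gw chi n \<omega>)"
proof (rule integrable_const_bound[where B = 1])
  show "(\<lambda>\<omega>. s ^ gw chi n \<omega>) \<in> borel_measurable M"
    by (rule measurable_compose[OF gw_measurable]) simp
qed (use assms in \<open>auto simp: power_le_one\<close>)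

text \<open>With marking probability \<open>1\<close> the generating function is evaluated at \<open>0\<close>, and
\<open>0 ^ k\<close> is the indicator of \<open>k = 0\<close>.\<close>

lemma prob_alive: "prob (alive_event n) = thin q n 1"
proof -
  have "1 - thin q n 1 = expectation (\<lambda>\<omega>. 0 ^ gw chi n \<omega>)"
    using expectation_gw_power[of 1 n] by simp
  also have "\<dots> = expectation (indicator (space M - alive_event n))"
    by (intro Bochner_Integration.integral_cong) (auto simp: indicator_def)
  also have "\<dots> = 1 - prob (alive_event n)"
    using alive_event_measurable by (simp add: prob_compl[symmetric] Int_absorb1)
  finally show ?thesis by simp
qed

lemma conditional_power:
  assumes x: "0 \<le> x" "x \<le> 1" and pos: "0 < thin q n 1"
  shows "(\<integral>\<omega>. (1 - x) ^ gw chi n \<omega> \<partial>uniform_measure M (alive_event n)) = 1 - thin q n x / thin q n 1"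
proof -
  have "(\<integral>\<omega>. (1 - x) ^ gw chi n \<omega> \<partial>uniform_measure M (alive_event n))
      = expectation (\<lambda>\<omega>. (1 - x) ^ gw chi n \<omega> * indicator (alive_event n) \<omega>) / thin q n 1"
    using x pos by (subst integral_uniform_measure)
      (auto simp: prob_alive intro!: alive_event_measurable integrable_gw_power)
  also have "expectation (\<lambda>\<omega>. (1 - x) ^ gw chi n \<omega> * indicator (alive_event n) \<omega>)
      = expectation (\<lambda>\<omega>. (1 - x) ^ gw chi n \<omega> - 0 ^ gw chi n \<omega>)"
    by (intro Bochner_Integration.integral_cong) (auto simp: indicator_def)
  also have "\<dots> = expectation (\<lambda>\<omega>. (1 - x) ^ gw chi n \<omega>) - expectation (\<lambda>\<omega>. (1 - 1) ^ gw chi n \<omega>)"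
    using integrable_gw_power[of "1 - x" n] integrable_gw_power[of 0 n] x by simp
  also have "\<dots> = thin q n 1 - thin q n x"
    using expectation_gw_power[of x n] expectation_gw_power[of 1 n] x by simp
  finally show ?thesis using pos by (simp add: diff_divide_distrib)
qed

end

section \<open>Laplace transforms and weak convergence\<close>

text \<open>The substitution \<open>y = exp (- x)\<close> maps the half-line into the unit interval, where the Laplace
transforms at integers become moments.  The trapezoidal test functions \<open>cts_step\<close>, which
determine weak convergence, become continuous functions vanishing near \<open>0\<close>, and Weierstrass
approximation replaces these by polynomials.\<close>

lemma laplace_transforms_imp_weak_conv:
  fixes \<mu> :: "nat \<Rightarrow> real measure" and \<nu> :: "real measure"
  assumes \<mu>: "\<And>n. real_distribution (\<mu> n)" and \<nu>: "real_distribution \<nu>"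
    and \<mu>0: "\<And>n. AE x in \<mu> n. 0 \<le> x" and \<nu>0: "AE x in \<nu>. 0 \<le> x"
    and conv: "\<And>j::nat. (\<lambda>n. \<integral>x. exp (- x) ^ j \<partial>\<mu> n) \<longlonglongrightarrow> (\<integral>x. exp (- x) ^ j \<partial>\<nu>)"
  shows "weak_conv_m \<mu> \<nu>"
proof (rule integral_cts_step_conv_imp_weak_conv[OF \<mu> \<nu>])
  fix a b :: real assume ab: "a < b"
  \<comment> \<open>The truncation at \<open>exp (- b)\<close> changes nothing, as \<open>cts_step a b\<close> vanishes beyond \<open>b\<close>, and keeps the logarithm away from \<open>0\<close>.\<close>
  define h where "h y = cts_step a b (- ln (max y (exp (- b))))" for y
  have h_exp: "h (exp (- x)) = cts_step a b x" for x
  proof -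
    have "max (exp (- x)) (exp (- b)) = exp (- min x b)" by (auto simp: max_def min_def)
    then have "h (exp (- x)) = cts_step a b (min x b)" unfolding h_def by simp
    then show ?thesis using ab by (auto simp: cts_step_def min_def)
  qed
  have "continuous_on UNIV (cts_step a b)"
    by (rule uniformly_continuous_imp_continuous[OF cts_step_uniformly_continuous[OF ab]])
  then have h_cont: "continuous_on {0..1} h"
    unfolding h_def
  proof (rule continuous_on_compose2)
    have "max y (exp (- b)) \<noteq> 0" for y :: real
      by (smt (verit) exp_gt_zero max.cobounded2)
    then show "continuous_on {0..1} (\<lambda>y. - ln (max y (exp (- b))))"
      by (intro continuous_intros) auto
  qed auto
  show "(\<lambda>n. integral\<^sup>L (\<mu> n) (cts_step a b)) \<longlonglongrightarrow> integral\<^sup>L \<nu> (cts_step a b)"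
  proof (rule tendstoI)
    fix e :: real assume e: "0 < e"
    obtain g where g: "real_polynomial_function g" "\<And>y. y \<in> {0..1} \<Longrightarrow> \<bar>h y - g y\<bar> < e / 3"
      by (rule Stone_Weierstrass_real_polynomial_function[OF compact_Icc h_cont, of "e / 3"]) (use e in auto)
    obtain c N where gc: "g = (\<lambda>y. \<Sum>i\<le>N. c i * y ^ i)"
      using g(1) unfolding real_polynomial_function_iff_sum by auto
    have *: "integral\<^sup>L \<rho> (\<lambda>x. g (exp (- x))) = (\<Sum>i\<le>N. c i * (\<integral>x. exp (- x) ^ i \<partial>\<rho>))"
        "\<bar>integral\<^sup>L \<rho> (cts_step a b) - integral\<^sup>L \<rho> (\<lambda>x. g (exp (- x)))\<bar> \<le> e / 3"
      if \<rho>: "real_distribution \<rho>" "AE x in \<rho>. 0 \<le> x" for \<rho>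
    proof -
      interpret real_distribution \<rho> by (rule \<rho>)
      have int: "integrable \<rho> (\<lambda>x. exp (- x) ^ i)" for i
      proof (rule integrable_const_bound[where B = 1])
        show "AE x in \<rho>. norm (exp (- x) ^ i) \<le> 1"
          using \<rho>(2) by eventually_elim (simp add: power_le_one)
      qed simp
      show "integral\<^sup>L \<rho> (\<lambda>x. g (exp (- x))) = (\<Sum>i\<le>N. c i * (\<integral>x. exp (- x) ^ i \<partial>\<rho>))"
        unfolding gc using int by simp
      have intg: "integrable \<rho> (\<lambda>x. g (exp (- x)))" unfolding gc using int by simp
      have ints: "integrable \<rho> (cts_step a b)" by (rule integrable_cts_step[OF ab])
      have "\<bar>integral\<^sup>L \<rho> (cts_step a b) - integral\<^sup>L \<rho> (\<lambda>x. g (exp (- x)))\<bar>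
          = \<bar>integral\<^sup>L \<rho> (\<lambda>x. cts_step a b x - g (exp (- x)))\<bar>"
        using ints intg by simp
      also have "\<dots> \<le> integral\<^sup>L \<rho> (\<lambda>x. \<bar>cts_step a b x - g (exp (- x))\<bar>)"
        by (rule integral_abs_bound)
      also have "\<dots> \<le> integral\<^sup>L \<rho> (\<lambda>x. e / 3)"
      proof (rule integral_mono_AE)
        show "AE x in \<rho>. \<bar>cts_step a b x - g (exp (- x))\<bar> \<le> e / 3"
          using \<rho>(2)
        proof eventually_elim
          case (elim x)
          then show ?case using g(2)[of "exp (- x)"] by (simp add: h_exp less_imp_le)
        qed
      qed (use ints intg in auto)
      finally show "\<bar>integral\<^sup>L \<rho> (cts_step a b) - integral\<^sup>L \<rho> (\<lambda>x. g (exp (- x)))\<bar> \<le> e / 3"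
        using prob_space by simp
    qed
    have "(\<lambda>n. integral\<^sup>L (\<mu> n) (\<lambda>x. g (exp (- x)))) \<longlonglongrightarrow> integral\<^sup>L \<nu> (\<lambda>x. g (exp (- x)))"
      unfolding *(1)[OF \<mu> \<mu>0] *(1)[OF \<nu> \<nu>0] by (intro tendsto_intros conv)
    then have "\<forall>\<^sub>F n in sequentially.
        dist (integral\<^sup>L (\<mu> n) (\<lambda>x. g (exp (- x)))) (integral\<^sup>L \<nu> (\<lambda>x. g (exp (- x)))) < e / 3"
      using e by (intro tendstoD) auto
    then show "\<forall>\<^sub>F n in sequentially. dist (integral\<^sup>L (\<mu> n) (cts_step a b)) (integral\<^sup>L \<nu> (cts_step a b)) < e"
    proof eventually_elim
      case (elim n)
      then show ?case using *(2)[OF \<mu> \<mu>0, of n] *(2)[OF \<nu> \<nu>0] unfolding dist_real_def by linarith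
    qed
  qed
qed

text \<open>The integrand against Lebesgue measure is, up to the factor \<open>1 + j\<close>, the exponential density of rate
\<open>1 + j\<close>.\<close>

lemma laplace_exponential:
  "(\<integral>x. exp (- x) ^ j \<partial>density lborel (exponential_density 1)) = 1 / (1 + real j)"
proof -
  have "(\<integral>x. exp (- x) ^ j \<partial>density lborel (exponential_density 1))
      = (\<integral>x. exponential_density 1 x * exp (- x) ^ j \<partial>lborel)"
    by (subst integral_real_density) (auto simp: exponential_density_nonneg)
  also have "\<dots> = (\<integral>x. exponential_density (1 + real j) x / (1 + real j) \<partial>lborel)"
  proof (intro Bochner_Integration.integral_cong refl)
    fix x :: real
    have "exp (- x) * exp (- x) ^ j = exp (- x * (1 + real j))"
      by (simp add: exp_of_nat_mult[symmetric] exp_add[symmetric] algebra_simps)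
    then show "exponential_density 1 x * exp (- x) ^ j = exponential_density (1 + real j) x / (1 + real j)"
      by (auto simp: exponential_density_def)
  qed
  also have "\<dots> = (\<integral>x. exponential_density (1 + real j) x \<partial>lborel) / (1 + real j)"
    by simp
  also have "(\<integral>x. exponential_density (1 + real j) x \<partial>lborel) = 1"
  proof -
    interpret prob_space "density lborel (exponential_density (1 + real j))"
      by (rule prob_space_exponential_density) simp
    have "(\<integral>x. 1 \<partial>density lborel (exponential_density (1 + real j))) = (1::real)"
      using prob_space by simp
    then show ?thesis
      by (subst (asm) integral_real_density) (auto simp: exponential_density_nonneg)
  qed
  finally show ?thesis .
qed

section \<open>The conditional limit law\<close>

theorem theorem1:
  fixes M :: "'a measure" and q :: "nat \<Rightarrow> nat pmf" and chi :: "nat \<Rightarrow> nat \<Rightarrow> 'a \<Rightarrow> nat"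
  assumes "offspring_family M q chi"
    and "critical_env q"
    and "\<exists>c>0. \<forall>n\<ge>1.
           gf_deriv1 3 (q n) \<le> ennreal c * gf_deriv1 2 (q n) * (1 + gf_deriv1 1 (q n))"
  shows "weak_conv_m
           (\<lambda>n. distr (uniform_measure M {\<omega> \<in> space M. gw chi n \<omega> > 0}) borel
                  (\<lambda>\<omega>. real (gw chi n \<omega>) / env_a q n))
           (density lborel (exponential_density 1))"
proof -
  interpret prob_space M using assms(1) unfolding offspring_family_def by blast
  interpret varying_offspring M q chi by unfold_locales (rule assms(1))
  interpret critical_third_moment q by unfold_locales (rule assms)+
  have pos: "0 < thin q n 1" for n by (rule thin_bounds) auto
  define U where "U n = uniform_measure M (alive_event n)" for n
  have U: "prob_space (U n)" for n
    unfolding U_def using pos[of n] alive_event_measurable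
    by (intro prob_space_uniform_measure) (auto simp: emeasure_eq_measure prob_alive)
  have X: "(\<lambda>\<omega>. real (gw chi n \<omega>) / env_a q n) \<in> borel_measurable (U n)" for n
    unfolding U_def by simp
  have a_nonneg: "0 \<le> env_a q n" for n
    unfolding env_a_def using less_imp_le[OF mu_pos] J_nonneg by (auto intro!: mult_nonneg_nonneg sum_nonneg)
  show ?thesis
    unfolding U_def[symmetric]
  proof (rule laplace_transforms_imp_weak_conv)
    show "real_distribution (distr (U n) borel (\<lambda>\<omega>. real (gw chi n \<omega>) / env_a q n))" for n
      by (rule prob_space.real_distribution_distr[OF U X])
    show "real_distribution (density lborel (exponential_density 1))"
      unfolding real_distribution_def real_distribution_axioms_def
      by (auto intro: prob_space_exponential_density)
    show "AE x in distr (U n) borel (\<lambda>\<omega>. real (gw chi n \<omega>) / env_a q n). 0 \<le> x" for n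
      using X a_nonneg by (subst AE_distr_iff) auto
    show "AE x in density lborel (exponential_density 1). 0 \<le> x"
      by (subst AE_density) (auto simp: exponential_density_def)
  next
    fix j :: nat
    let ?L = "\<lambda>n. \<integral>x. exp (- x) ^ j \<partial>distr (U n) borel (\<lambda>\<omega>. real (gw chi n \<omega>) / env_a q n)"
    have L: "?L n = 1 - thin q n (1 - exp (- real j / env_a q n)) / thin q n 1" for n
    proof -
      have "?L n = (\<integral>\<omega>. exp (- (real (gw chi n \<omega>) / env_a q n)) ^ j \<partial>U n)"
        by (rule integral_distr[OF X]) simp
      also have "\<dots> = (\<integral>\<omega>. (1 - (1 - exp (- real j / env_a q n))) ^ gw chi n \<omega> \<partial>U n)"
        by (intro Bochner_Integration.integral_cong) (simp_all add: exp_of_nat_mult[symmetric] mult_ac)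
      also have "\<dots> = 1 - thin q n (1 - exp (- real j / env_a q n)) / thin q n 1"
        unfolding U_def using a_nonneg pos by (intro conditional_power) auto
      finally show ?thesis .
    qed
    have "?L \<longlonglongrightarrow> 1 / (1 + real j)"
    proof (cases "j = 0")
      case True
      have "thin q n 0 = 0" for n by (induction n) (simp_all add: alive_def)
      then show ?thesis unfolding L using True by simp
    next
      case False
      then have "(\<lambda>n. 1 - thin q n (1 - exp (- real j / env_a q n)) / thin q n 1)
          \<longlonglongrightarrow> 1 - real j / (1 + real j)"
        by (intro tendsto_diff tendsto_const thin_ratio_limit) simp
      moreover have "1 - real j / (1 + real j) = 1 / (1 + real j)" by (simp add: field_simps)
      ultimately show ?thesis unfolding L by simp
    qed
    then show "?L \<longlonglongrightarrow> (\<integral>x. exp (- x) ^ j \<partial>density lborel (exponential_density 1))"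
      unfolding laplace_exponential .
  qed
qed

end
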